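(* Consider the single-server ($K=1$) task-based flow-time-plus-energy problem described in the context, with power function $P(s)=s^\alpha$ where $1<\alpha<2$. Then the online algorithm described in the context has competitive ratio at most $8+\frac{4}{2-\alpha}+3^{\alpha}$.
   Context: Model: a single server that may process several tasks simultaneously, each task $x$ being processed at its own rate $s_x(t)$; the server's total speed is $s(t)=\sum_x s_x(t)$ and it consumes power $P(s(t))$. A finite set of jobs is given; job $i$ is released at time $a_i$ and consists of $m_i$ map tasks and $\mathsf r$ reduce tasks with arbitrary positive sizes (work); every job has the same number $\mathsf r$ of reduce tasks (a standing assumption of this setting). MapReduce constraint: a reduce task of job $i$ may be processed only after all map tasks of job $i$ are completed; a reduce task is free once all map tasks of its job are completed. Preemption is allowed. The flow time of a task of job $i$ completed at time $c$ is $c-a_i$. The task-based cost is $\int n(t)\,dt+\int P(s(t))\,dt$, where $n(t)$ is the number of unfinished (map or reduce) tasks. An online algorithm learns about job $i$ only at time $a_i$. The competitive ratio of $A$ is $\sup_\sigma C^A(\sigma)/C^{\mathsf{OPT}}(\sigma)$, where $\mathsf{OPT}$ is the minimum cost over all feasible schedules chosen with full knowledge of the input. Algorithm: at time $t$ let $m(t)$ be the number of unfinished map tasks (over all jobs), $r_f(t)$ the number of unfinished free reduce tasks, and $J(t)$ the number of jobs with at least one unfinished map task. The cumulative remaining map size of a job is the sum of the remaining sizes of its map tasks. The algorithm simultaneously processes: ($M_1$) the unfinished map task with the smallest remaining size, at rate $P^{-1}(m(t)+1)$; ($M_2$) the shortest remaining map task of the job with the smallest cumulative remaining map size, at rate $P^{-1}(\mathsf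 r J(t)+1)$; ($R_f$) the free reduce task with the smallest remaining size, at rate $P^{-1}(r_f(t)+1)$. (If $M_1$ and $M_2$ coincide, only two tasks are processed.) The total speed is the sum of these rates. *)

theory Defs
  imports "HOL-Analysis.Analysis"
begin

text \<open>A MapReduce instance on a single server.  Jobs are numbered 0, ..., njobs-1.
  Job i is released at time rel i, has nmap i map tasks with sizes msize i k (k < nmap i)
  and nred reduce tasks (the same number for every job) with sizes rsize i k (k < nred).\<close>
record mrinst =
  njobs :: nat
  rel   :: "nat \<Rightarrow> real"
  nmap  :: "nat \<Rightarrow> nat"
  nred  :: nat
  msize :: "nat \<Rightarrow> nat \<Rightarrow> real"
  rsize :: "nat \<Rightarrow> nat \<Rightarrow> real"

datatype task = MapT nat nat | RedT nat nat

fun job :: "task \<Rightarrow> nat" where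
  "job (MapT i k) = i" | "job (RedT i k) = i"

fun is_map :: "task \<Rightarrow> bool" where
  "is_map (MapT i k) = True" | "is_map (RedT i k) = False"

definition tasks :: "mrinst \<Rightarrow> task set" where
  "tasks I = {MapT i k | i k. i < njobs I \<and> k < nmap I i}
           \<union> {RedT i k | i k. i < njobs I \<and> k < nred I}"

fun tsize :: "mrinst \<Rightarrow> task \<Rightarrow> real" where
  "tsize I (MapT i k) = msize I i k" | "tsize I (RedT i k) = rsize I i k"

definition release :: "mrinst \<Rightarrow> task \<Rightarrow> real" where
  "release I x = rel I (job x)"

definition valid_instance :: "mrinst \<Rightarrow> bool" where
  "valid_instance I \<longleftrightarrow> (\<forall>x \<in> tasks I. 0 < tsize I x)"

text \<open>A schedule assigns to each task x its processing rate s_x(t) at time t.\<close>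
type_synonym schedule = "task \<Rightarrow> real \<Rightarrow> real"

definition work :: "schedule \<Rightarrow> task \<Rightarrow> real \<Rightarrow> ennreal" where
  "work S x t = (\<integral>\<^sup>+ u. ennreal (S x u) * indicator {..t} u \<partial>lborel)"

definition is_done :: "mrinst \<Rightarrow> schedule \<Rightarrow> task \<Rightarrow> real \<Rightarrow> bool" where
  "is_done I S x t \<longleftrightarrow> ennreal (tsize I x) \<le> work S x t"

definition unfinished :: "mrinst \<Rightarrow> schedule \<Rightarrow> task \<Rightarrow> real \<Rightarrow> bool" where
  "unfinished I S x t \<longleftrightarrow> x \<in> tasks I \<and> release I x \<le> t \<and> \<not> is_done I S x t"

definition feasible :: "mrinst \<Rightarrow> schedule \<Rightarrow> bool" where
  "feasible I S \<longleftrightarrow>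
     (\<forall>x. S x \<in> borel_measurable lborel) \<and>
     (\<forall>x t. 0 \<le> S x t) \<and>
     (\<forall>x t. t < release I x \<longrightarrow> S x t = 0) \<and>
     (\<forall>i k t. S (RedT i k) t \<noteq> 0 \<longrightarrow> (\<forall>k' < nmap I i. is_done I S (MapT i k') t))"

definition cost :: "mrinst \<Rightarrow> real \<Rightarrow> schedule \<Rightarrow> ennreal" where
  "cost I \<alpha> S = (\<integral>\<^sup>+ t. ennreal (real (card {x. unfinished I S x t})
                         + (\<Sum>x\<in>tasks I. S x t) powr \<alpha>) \<partial>lborel)"

definition OPT :: "mrinst \<Rightarrow> real \<Rightarrow> ennreal" where
  "OPT I \<alpha> = (INF S \<in> {S. feasible I S}. cost I \<alpha> S)"

definition rem :: "mrinst \<Rightarrow> schedule \<Rightarrow> task \<Rightarrow> real \<Rightarrow> real" where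
  "rem I S x t = tsize I x - enn2real (work S x t)"

definition umaps :: "mrinst \<Rightarrow> schedule \<Rightarrow> real \<Rightarrow> task set" where
  "umaps I S t = {x. unfinished I S x t \<and> is_map x}"

definition freereds :: "mrinst \<Rightarrow> schedule \<Rightarrow> real \<Rightarrow> task set" where
  "freereds I S t = {x. unfinished I S x t \<and> \<not> is_map x \<and>
                        (\<forall>k < nmap I (job x). is_done I S (MapT (job x) k) t)}"

definition ajobs :: "mrinst \<Rightarrow> schedule \<Rightarrow> real \<Rightarrow> nat set" where
  "ajobs I S t = job ` umaps I S t"

definition cumrem :: "mrinst \<Rightarrow> schedule \<Rightarrow> nat \<Rightarrow> real \<Rightarrow> real" where
  "cumrem I S i t = (\<Sum>x \<in> {y \<in> umaps I S t. job y = i}. rem I S x t)"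

text \<open>S follows the algorithm: at every time t the rates are those prescribed by M1, M2, Rf
  (for some choice among ties); if M1 and M2 pick the same task, its rate is the sum.\<close>
definition alg_rule :: "mrinst \<Rightarrow> real \<Rightarrow> schedule \<Rightarrow> bool" where
  "alg_rule I \<alpha> S \<longleftrightarrow> (\<forall>t. \<exists>x1 x2 x3.
     (umaps I S t \<noteq> {} \<longrightarrow>
        x1 \<in> umaps I S t \<and> (\<forall>y \<in> umaps I S t. rem I S x1 t \<le> rem I S y t) \<and>
        x2 \<in> umaps I S t \<and> (\<forall>j \<in> ajobs I S t. cumrem I S (job x2) t \<le> cumrem I S j t) \<and>
        (\<forall>y \<in> umaps I S t. job y = job x2 \<longrightarrow> rem I S x2 t \<le> rem I S y t)) \<and>
     (freereds I S t \<noteq> {} \<longrightarrow>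
        x3 \<in> freereds I S t \<and> (\<forall>y \<in> freereds I S t. rem I S x3 t \<le> rem I S y t)) \<and>
     (\<forall>x. S x t =
          (if umaps I S t \<noteq> {} \<and> x = x1
             then (real (card (umaps I S t)) + 1) powr (1/\<alpha>) else 0)
        + (if umaps I S t \<noteq> {} \<and> x = x2
             then (real (nred I * card (ajobs I S t)) + 1) powr (1/\<alpha>) else 0)
        + (if freereds I S t \<noteq> {} \<and> x = x3
             then (real (card (freereds I S t)) + 1) powr (1/\<alpha>) else 0)))"

end

theory Submission
  imports Defs
begin

text \<open>
  Amortised analysis against an arbitrary feasible schedule of finite cost. If \<open>D q\<close> is the number
  of items whose remaining size under the algorithm is at least \<open>q\<close>, minus the same number for
  the competitor, the potential is the integral over \<open>q > 0\<close> of \<open>f (D q)\<close> for a convex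
  function \<open>f\<close> that vanishes on the nonpositive integers and has
  increments \<open>f k - f (k - 1) = P' (P\<^sup>-\<^sup>1 (c k)) = \<alpha> (c k)\<^bsup>1 - 1/\<alpha>\<^esup>\<close>. Unreleased items
  cancel in \<open>D\<close>, so arrivals cause no jump. Processing the smallest of \<open>n\<close> items at
  rate \<open>P\<^sup>-\<^sup>1 (c n + 1)\<close> lowers the potential at rate at least \<open>\<alpha> c (n - n')\<close> where \<open>n'\<close> counts the
  competitor's items, whereas by Young's inequality the competitor, running at speed \<open>s\<close>, raises
  it at rate at most \<open>s\<^bsup>\<alpha>\<^esup> + (\<alpha> - 1) c n\<close>.

  This is applied to map tasks (\<open>M\<^sub>1\<close>), to jobs measured by their cumulative
  remaining map size with \<open>c = r\<close> (\<open>M\<^sub>2\<close>), and to all reduce tasks (\<open>R\<^sub>f\<close>). In the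
  last case the reduce tasks that are not yet free, \<open>r J\<close> in number, leave an excess
  \<open>(\<alpha> - 1) r J\<close>, which is paid for by giving the second potential the weight \<open>\<alpha>\<close>
  relative to the third. Since the competitor is merely measurable, the drift is controlled at almost
  every time only; subtracting an absolutely continuous bound makes the potential monotone, so that
  Fatou's lemma integrates the drift.
\<close>

section \<open>Drift at almost every time\<close>

definition dini_le :: "(real \<Rightarrow> real) \<Rightarrow> real \<Rightarrow> real \<Rightarrow> bool" where
  "dini_le F t d \<longleftrightarrow> (\<forall>e>0. \<forall>\<^sub>F u in at_right t. F u \<le> F t + (u - t) * (d + e))"

lemma dini_le_mono:
  assumes "dini_le F t d" "d \<le> d'"
  shows "dini_le F t d'"
  unfolding dini_le_def
proof (intro allI impI)
  fix e :: real assume "e > 0"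
  then have "\<forall>\<^sub>F u in at_right t. F u \<le> F t + (u - t) * (d + e)"
    using assms(1) by (simp add: dini_le_def)
  then show "\<forall>\<^sub>F u in at_right t. F u \<le> F t + (u - t) * (d' + e)"
    using eventually_at_right_less[of t]
  proof eventually_elim
    case (elim u)
    then have "(u - t) * (d + e) \<le> (u - t) * (d' + e)"
      using assms(2) by (intro mult_left_mono) auto
    then show ?case using elim by linarith
  qed
qed

lemma dini_le_add:
  assumes "dini_le F t d" "dini_le G t d'"
  shows "dini_le (\<lambda>u. F u + G u) t (d + d')"
  unfolding dini_le_def
proof (intro allI impI)
  fix e :: real assume "e > 0"
  then have "\<forall>\<^sub>F u in at_right t. F u \<le> F t + (u - t) * (d + e / 2)"
    "\<forall>\<^sub>F u in at_right t. G u \<le> G t + (u - t) * (d' + e / 2)"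
    using assms by (auto simp: dini_le_def)
  then show "\<forall>\<^sub>F u in at_right t. F u + G u \<le> F t + G t + (u - t) * (d + d' + e)"
    by eventually_elim (simp add: field_simps)
qed

lemma dini_le_cmult:
  assumes "dini_le F t d" "0 \<le> c"
  shows "dini_le (\<lambda>u. c * F u) t (c * d)"
proof (cases "c = 0")
  case False
  then have "c > 0" using assms(2) by simp
  show ?thesis
    unfolding dini_le_def
  proof (intro allI impI)
    fix e :: real assume "e > 0"
    then have "\<forall>\<^sub>F u in at_right t. F u \<le> F t + (u - t) * (d + e / c)"
      using assms(1) \<open>c > 0\<close> by (simp add: dini_le_def)
    then show "\<forall>\<^sub>F u in at_right t. c * F u \<le> c * F t + (u - t) * (c * d + e)"
    proof eventually_elim
      case (elim u)
      then have "c * F u \<le> c * (F t + (u - t) * (d + e / c))"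
        using assms(2) by (rule mult_left_mono)
      also have "\<dots> = c * F t + (u - t) * (c * d + e)"
        using \<open>c > 0\<close> by (simp add: field_simps)
      finally show ?case .
    qed
  qed
qed (simp add: dini_le_def eventually_mono[OF eventually_at_right_less])

lemma dini_le_if_has_real_derivative:
  assumes "(F has_real_derivative d) (at_right t)"
  shows "dini_le F t d"
  unfolding dini_le_def
proof (intro allI impI)
  fix e :: real assume "e > 0"
  have "((\<lambda>u. (F u - F t) / (u - t)) \<longlongrightarrow> d) (at_right t)"
    using assms by (simp add: has_field_derivative_iff)
  then have "\<forall>\<^sub>F u in at_right t. (F u - F t) / (u - t) < d + e"
    using \<open>e > 0\<close> by (intro order_tendstoD) auto
  then show "\<forall>\<^sub>F u in at_right t. F u \<le> F t + (u - t) * (d + e)"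
    using eventually_at_right_less[of t] by eventually_elim (simp add: field_simps)
qed

lemma dini_le_if_eventually_le:
  assumes "dini_le G t d" "\<forall>\<^sub>F u in at_right t. F u \<le> G u" "F t = G t"
  shows "dini_le F t d"
  unfolding dini_le_def
proof (intro allI impI)
  fix e :: real assume "e > 0"
  then have "\<forall>\<^sub>F u in at_right t. G u \<le> G t + (u - t) * (d + e)"
    using assms(1) by (simp add: dini_le_def)
  with assms(2) show "\<forall>\<^sub>F u in at_right t. F u \<le> F t + (u - t) * (d + e)"
    by eventually_elim (simp add: assms(3))
qed

lemma dini_le_min:
  assumes "dini_le F t d" "t < b"
  shows "dini_le (\<lambda>u. F (min u b)) t d"
proof (rule dini_le_if_eventually_le[OF assms(1)])
  show "\<forall>\<^sub>F u in at_right t. F (min u b) \<le> F u"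
    unfolding eventually_at_right_field using assms(2) by (intro exI[of _ b]) auto
qed (use assms(2) in simp)

lemma eventually_pos_at_right:
  fixes f :: "real \<Rightarrow> real"
  assumes "(f has_real_derivative d) (at_right t)" "0 < f t"
  shows "\<forall>\<^sub>F u in at_right t. 0 < f u"
  using assms(2) DERIV_continuous[OF assms(1)]
  by (auto simp: continuous_within intro: order_tendstoD)

lemma has_real_derivative_max_0_at_right:
  fixes f :: "real \<Rightarrow> real"
  assumes f: "antimono f" "(f has_real_derivative d) (at_right t)"
  shows "((\<lambda>u. max 0 (f u)) has_real_derivative (if 0 < f t then d else 0)) (at_right t)"
proof (cases "0 < f t")
  case True
  then have "\<forall>\<^sub>F u in at_right t. max 0 (f u) = f u"
    using eventually_pos_at_right[OF f(2)] by (auto elim: eventually_mono)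
  then show ?thesis
    using True f(2) by (subst has_field_derivative_cong_eventually[where g = f]) auto
next
  case False
  have "\<forall>\<^sub>F u in at_right t. max 0 (f u) = 0"
    using eventually_at_right_less[of t]
  proof eventually_elim
    case (elim u)
    then show ?case using False antimonoD[OF f(1), of t u] by simp
  qed
  then show ?thesis
    using False by (subst has_field_derivative_cong_eventually[where g = "\<lambda>_. 0"]) auto
qed

lemma AE_has_right_derivative_integral:
  fixes F f :: "real \<Rightarrow> real"
  assumes f: "\<And>x y. set_integrable lborel {x..y} f"
    and F: "\<And>x y. x \<le> y \<Longrightarrow> F y - F x = (LINT v:{x..y}|lborel. f v)"
  shows "AE t in lborel. (F has_real_derivative f t) (at_right t)"
proof -
  note f_HK = set_borel_integral_eq_integral[OF f]
  obtain N where "negligible N" and N: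
    "\<And>x e. \<lbrakk>x \<notin> N; 0 < e\<rbrakk> \<Longrightarrow> \<exists>d>0. \<forall>h. 0 < h \<and> h < d \<longrightarrow>
          norm (integral (cbox x (x + h *\<^sub>R One)) f /\<^sub>R h ^ DIM(real) - f x) < e"
    using integrable_ccontinuous_explicit[of f] f_HK(1) by (metis box_real(2))
  have "(F has_real_derivative f t) (at_right t)" if "t \<notin> N" for t
    unfolding has_field_derivative_iff tendsto_iff
  proof (intro allI impI)
    fix e :: real assume "e > 0"
    then obtain d where "d > 0" and d: "\<And>h. 0 < h \<Longrightarrow> h < d \<Longrightarrow> \<bar>integral {t..t + h} f / h - f t\<bar> < e"
      using N[OF \<open>t \<notin> N\<close>, of e] by (auto simp: inverse_eq_divide)
    have "dist ((F u - F t) / (u - t)) (f t) < e" if "t < u" "u < t + d" for u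
      using d[of "u - t"] that F[of t u] by (simp add: f_HK(2) dist_real_def)
    then show "\<forall>\<^sub>F u in at_right t. dist ((F u - F t) / (u - t)) (f t) < e"
      using \<open>d > 0\<close> unfolding eventually_at_right_field by (intro exI[of _ "t + d"]) auto
  qed
  moreover have "AE t in lebesgue. t \<notin> N"
    using \<open>negligible N\<close> by (simp add: AE_not_in negligible_iff_null_sets)
  ultimately show ?thesis
    unfolding AE_completion_iff by (auto elim: eventually_mono)
qed

lemma borel_measurable_antimono:
  fixes f :: "real \<Rightarrow> real"
  assumes "antimono f"
  shows "f \<in> borel_measurable borel"
  using borel_measurable_uminus[OF borel_measurable_mono[of "\<lambda>t. - f t"]] assms
  by (simp add: antimono_def mono_def)

lemma nn_integral_difference_quotient_le:
  fixes F :: "real \<Rightarrow> real"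
  assumes "antimono F" "a \<le> b" "0 < d"
  shows "(\<integral>\<^sup>+t\<in>{a..b}. ennreal ((F t - F (t + d)) / d) \<partial>lborel) \<le> ennreal (F a - F (b + d))"
proof -
  have F_int: "F integrable_on {x..y}" for x y
  proof -
    have "mono_on {x..y} (\<lambda>t. - F t)" using assms(1) by (auto simp: mono_on_def dest: antimonoD)
    from integrable_neg[OF integrable_on_mono_on[OF this]] show ?thesis by simp
  qed
  have [measurable]: "F \<in> borel_measurable borel"
    using assms(1) by (rule borel_measurable_antimono)
  have "((F \<circ> (+) d) has_integral integral {a + d..b + d} F) {a..b}"
    using F_int by (simp add: has_integral_shift_Icc_real integrable_integral)
  then have "((\<lambda>t. F (t + d)) has_integral integral {a + d..b + d} F) {a..b}"
    by (simp add: comp_def add.commute)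
  then have quotient: "((\<lambda>t. (F t - F (t + d)) / d) has_integral
      (integral {a..b} F - integral {a + d..b + d} F) / d) {a..b}"
    by (intro has_integral_divide has_integral_diff integrable_integral F_int)
  have "integral {a..a + d} F + integral {a + d..b + d} F = integral {a..b} F + integral {b..b + d} F"
    using assms F_int by (simp add: Henstock_Kurzweil_Integration.integral_combine)
  moreover have "integral {a..a + d} F \<le> integral {a..a + d} (\<lambda>_. F a)"
    using assms F_int by (intro integral_le) (auto dest: antimonoD)
  moreover have "integral {b..b + d} (\<lambda>_. F (b + d)) \<le> integral {b..b + d} F"
    using assms F_int by (intro integral_le) (auto dest: antimonoD)
  ultimately have le: "(integral {a..b} F - integral {a + d..b + d} F) / d \<le> F a - F (b + d)"
    using assms by (simp add: field_simps)
  have "(\<integral>\<^sup>+t\<in>{a..b}. ennreal ((F t - F (t + d)) / d) \<partial>lborel)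
      = (\<integral>\<^sup>+t. ennreal (if t \<in> {a..b} then (F t - F (t + d)) / d else 0) \<partial>lborel)"
    by (intro nn_integral_cong) auto
  also have "\<dots> = ennreal ((integral {a..b} F - integral {a + d..b + d} F) / d)"
    by (intro nn_integral_has_integral_lborel has_integral_restrict_UNIV[THEN iffD2] quotient)
       (use assms(3) antimonoD[OF assms(1)] in simp_all)
  also have "\<dots> \<le> ennreal (F a - F (b + d))" using le by (rule ennreal_leI)
  finally show ?thesis .
qed

lemma ennreal_le_liminf_difference_quotient:
  assumes "dini_le F t D" and d: "\<And>n. 0 < d n" "d \<longlonglongrightarrow> 0"
  shows "ennreal (- D) \<le> liminf (\<lambda>n. ennreal ((F t - F (t + d n)) / d n))"
  unfolding le_Liminf_iff
proof (intro allI impI)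
  fix y assume "y < ennreal (- D)"
  then obtain r where y: "y = ennreal r" "0 \<le> r" and "r < - D"
    by (cases y) (auto simp: ennreal_less_iff)
  define s where "s = (r - D) / 2"
  have "r < s" "s < - D" using \<open>r < - D\<close> by (auto simp: s_def)
  then have "\<forall>\<^sub>F u in at_right t. F u \<le> F t + (u - t) * (D + (- D - s))"
    using assms(1) unfolding dini_le_def by (metis diff_gt_0_iff_gt)
  moreover have "filterlim (\<lambda>n. t + d n) (at_right t) sequentially"
    unfolding filterlim_at using d(1) tendsto_add[OF tendsto_const[of t] d(2)]
    by (simp add: less_imp_neq[symmetric])
  ultimately have "\<forall>\<^sub>F n in sequentially. F (t + d n) \<le> F t - d n * s"
    by (auto dest: eventually_compose_filterlim)
  then show "\<forall>\<^sub>F n in sequentially. y < ennreal ((F t - F (t + d n)) / d n)"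
  proof eventually_elim
    case (elim n)
    then have "s \<le> (F t - F (t + d n)) / d n" using d(1)[of n] by (simp add: field_simps)
    then show ?case using \<open>r < s\<close> y by (simp add: ennreal_less_iff)
  qed
qed

lemma nn_integral_eq_set_integral:
  assumes "set_integrable M A f" "\<And>x. x \<in> A \<Longrightarrow> 0 \<le> f x"
  shows "(\<integral>\<^sup>+x\<in>A. ennreal (f x) \<partial>M) = ennreal (LINT x:A|M. f x)"
proof -
  have "(\<integral>\<^sup>+x\<in>A. ennreal (f x) \<partial>M) = (\<integral>\<^sup>+x. ennreal (indicator A x *\<^sub>R f x) \<partial>M)"
    by (intro nn_integral_cong) (auto split: split_indicator)
  also have "\<dots> = ennreal (LINT x:A|M. f x)"
    using assms unfolding set_lebesgue_integral_def set_integrable_def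
    by (intro nn_integral_eq_integral) (auto split: split_indicator)
  finally show ?thesis .
qed

lemma set_integral_le_if_nn_integral_le:
  fixes f :: "'a \<Rightarrow> real"
  assumes f: "set_integrable M A f" and le: "(\<integral>\<^sup>+x\<in>A. ennreal (f x) \<partial>M) \<le> ennreal c" and "0 \<le> c"
  shows "(LINT x:A|M. f x) \<le> c"
proof -
  have pos: "set_integrable M A (\<lambda>x. max 0 (f x))"
  proof -
    have "set_integrable M A (\<lambda>x. (\<bar>f x\<bar> + f x) / 2)"
      using f by (intro set_integrable_divide set_integral_add set_integrable_abs)
    moreover have "max 0 (f x) = (\<bar>f x\<bar> + f x) / 2" for x by (simp add: max_def abs_if)
    ultimately show ?thesis by (simp only:)
  qed
  have "ennreal (LINT x:A|M. max 0 (f x)) \<le> ennreal c"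
    using le by (simp flip: nn_integral_eq_set_integral[OF pos] add: ennreal_max_0)
  moreover have "(LINT x:A|M. f x) \<le> (LINT x:A|M. max 0 (f x))"
    using f pos by (rule set_integral_mono) simp
  ultimately show ?thesis using \<open>0 \<le> c\<close> by simp
qed

text \<open>Fatou's lemma applied to difference quotients, which \<^term>\<open>antimono F\<close> makes nonnegative.\<close>

lemma antimono_diff_le_integral_dini:
  assumes F: "antimono F" and "a \<le> b" and h: "set_integrable lborel {a..b} h"
    and dini: "AE t in lborel. dini_le F t (h t)"
  shows "F b - F a \<le> (LINT t:{a..b}|lborel. h t)"
proof -
  define F' where "F' t = F (min t b)" for t
  have F': "antimono F'" using F by (auto simp: F'_def antimono_def)
  have [measurable]: "F' \<in> borel_measurable borel"
    using F' by (rule borel_measurable_antimono)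
  obtain d :: "nat \<Rightarrow> real" where d: "\<And>n. 0 < d n" "d \<longlonglongrightarrow> 0"
    using LIMSEQ_inverse_real_of_nat
    by (metis inverse_positive_iff_positive of_nat_0_less_iff zero_less_Suc)
  have "AE t in lborel. ennreal (- h t) * indicator {a..b} t
      \<le> liminf (\<lambda>n. ennreal ((F' t - F' (t + d n)) / d n) * indicator {a..b} t)"
    using dini AE_lborel_singleton[of b]
  proof eventually_elim
    case (elim t)
    then have "dini_le F' t (h t)" if "t \<in> {a..b}"
      unfolding F'_def using that by (intro dini_le_min) auto
    then show ?case
      using ennreal_le_liminf_difference_quotient[OF _ d] by (cases "t \<in> {a..b}") auto
  qed
  then have "(\<integral>\<^sup>+t\<in>{a..b}. ennreal (- h t) \<partial>lborel)
      \<le> (\<integral>\<^sup>+t. liminf (\<lambda>n. ennreal ((F' t - F' (t + d n)) / d n) * indicator {a..b} t) \<partial>lborel)"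
    by (rule nn_integral_mono_AE)
  also have "\<dots> \<le> liminf (\<lambda>n. \<integral>\<^sup>+t\<in>{a..b}. ennreal ((F' t - F' (t + d n)) / d n) \<partial>lborel)"
    by (rule nn_integral_liminf) measurable
  also have "\<dots> \<le> liminf (\<lambda>n. ennreal (F' a - F' (b + d n)))"
    using nn_integral_difference_quotient_le[OF F' \<open>a \<le> b\<close> d(1)] by (intro Liminf_mono) simp
  also have "\<dots> = ennreal (F a - F b)"
    using \<open>a \<le> b\<close> less_imp_le[OF d(1)] by (simp add: F'_def Liminf_const)
  finally have "(LINT t:{a..b}|lborel. - h t) \<le> F a - F b"
    using h antimonoD[OF F \<open>a \<le> b\<close>]
    by (intro set_integral_le_if_nn_integral_le) (auto simp: set_integrable_def)
  then show ?thesis by (simp add: set_lebesgue_integral_def)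
qed

lemma diff_le_integral_dini:
  assumes "a \<le> b" and g: "set_integrable lborel {a..b} g"
    and G: "\<And>x y. set_integrable lborel {x..y} G"
    and A: "\<And>x y. x \<le> y \<Longrightarrow> A y - A x = (LINT t:{x..y}|lborel. G t)"
    and growth: "\<And>x y. x \<le> y \<Longrightarrow> \<Phi> y - \<Phi> x \<le> A y - A x"
    and dini: "AE t in lborel. dini_le \<Phi> t (g t)"
  shows "\<Phi> b - \<Phi> a \<le> (LINT t:{a..b}|lborel. g t)"
proof -
  have A_deriv: "AE t in lborel. (A has_real_derivative G t) (at_right t)"
    using G A by (rule AE_has_right_derivative_integral)
  have "antimono (\<lambda>t. \<Phi> t - A t)"
    using growth by (auto intro!: antimonoI simp: algebra_simps)
  moreover have "AE t in lborel. dini_le (\<lambda>t. \<Phi> t - A t) t (g t - G t)"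
    using A_deriv dini
  proof eventually_elim
    case (elim t)
    have "dini_le (\<lambda>t. - A t) t (- G t)"
      using elim(1) by (intro dini_le_if_has_real_derivative DERIV_minus)
    then show ?case using dini_le_add[OF elim(2)] by fastforce
  qed
  ultimately have "\<Phi> b - A b - (\<Phi> a - A a) \<le> (LINT t:{a..b}|lborel. g t - G t)"
    using \<open>a \<le> b\<close> g G by (intro antimono_diff_le_integral_dini set_integral_diff)
  also have "\<dots> = (LINT t:{a..b}|lborel. g t) - (A b - A a)"
    using g G A[OF \<open>a \<le> b\<close>] by (simp add: set_integral_diff)
  finally show ?thesis by simp
qed

lemma nn_integral_le_if_centred_intervals:
  fixes f :: "real \<Rightarrow> ennreal"
  assumes [measurable]: "f \<in> borel_measurable borel"
    and le: "\<And>n. (\<integral>\<^sup>+x\<in>{c - real n..c + real n}. f x \<partial>lborel) \<le> C"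
  shows "(\<integral>\<^sup>+x. f x \<partial>lborel) \<le> C"
proof -
  have "(SUP n. f x * indicator {c - real n..c + real n} x) = f x" for x
  proof (rule antisym)
    show "(SUP n. f x * indicator {c - real n..c + real n} x) \<le> f x"
      by (intro SUP_least) (auto split: split_indicator)
    obtain n where "\<bar>x - c\<bar> \<le> real n" using real_arch_simple by blast
    then show "f x \<le> (SUP n. f x * indicator {c - real n..c + real n} x)"
      by (intro SUP_upper2[of n]) (auto simp: abs_le_iff)
  qed
  then have "(\<integral>\<^sup>+x. f x \<partial>lborel)
      = (\<integral>\<^sup>+x. (SUP n. f x * indicator {c - real n..c + real n} x) \<partial>lborel)"
    by simp
  also have "\<dots> = (SUP n. \<integral>\<^sup>+x\<in>{c - real n..c + real n}. f x \<partial>lborel)"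
    by (intro nn_integral_monotone_convergence_SUP)
       (auto simp: incseq_def le_fun_def split: split_indicator)
  also have "\<dots> \<le> C" using le by (rule SUP_least)
  finally show ?thesis .
qed

lemma amortized_nn_integral_le:
  assumes f: "f \<in> borel_measurable borel" "\<And>x y. set_integrable lborel {x..y} f" "\<And>t. 0 \<le> f t"
    and g: "\<And>x y. set_integrable lborel {x..y} g" "\<And>t. 0 \<le> g t"
    and G: "\<And>x y. set_integrable lborel {x..y} G"
    and A: "\<And>x y. x \<le> y \<Longrightarrow> A y - A x = (LINT t:{x..y}|lborel. G t)"
    and growth: "\<And>x y. x \<le> y \<Longrightarrow> \<Phi> y - \<Phi> x \<le> A y - A x"
    and dini: "AE t in lborel. dini_le \<Phi> t (g t - f t)"
    and nonneg: "\<And>t. 0 \<le> \<Phi> t" and start: "\<And>t. t \<le> t0 \<Longrightarrow> \<Phi> t = 0"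
  shows "(\<integral>\<^sup>+t. ennreal (f t) \<partial>lborel) \<le> (\<integral>\<^sup>+t. ennreal (g t) \<partial>lborel)"
proof (rule nn_integral_le_if_centred_intervals)
  fix n
  let ?I = "{t0 - real n..t0 + real n}"
  have "0 \<le> \<Phi> (t0 + real n) - \<Phi> (t0 - real n)" using nonneg start by simp
  also have "\<dots> \<le> (LINT t:?I|lborel. g t - f t)"
    using f g by (intro diff_le_integral_dini[OF _ _ G A growth dini] set_integral_diff) auto
  also have "\<dots> = (LINT t:?I|lborel. g t) - (LINT t:?I|lborel. f t)"
    using f g by (intro set_integral_diff)
  finally have "(LINT t:?I|lborel. f t) \<le> (LINT t:?I|lborel. g t)" by simp
  then have "(\<integral>\<^sup>+t\<in>?I. ennreal (f t) \<partial>lborel) \<le> (\<integral>\<^sup>+t\<in>?I. ennreal (g t) \<partial>lborel)"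
    using f g by (simp add: nn_integral_eq_set_integral ennreal_leI)
  also have "\<dots> \<le> (\<integral>\<^sup>+t. ennreal (g t) \<partial>lborel)"
    by (intro nn_integral_mono) (auto split: split_indicator)
  finally show "(\<integral>\<^sup>+t\<in>?I. ennreal (f t) \<partial>lborel) \<le> (\<integral>\<^sup>+t. ennreal (g t) \<partial>lborel)" .
qed (use f in simp)

lemma ennreal_le_mult_INF:
  assumes "0 < c" "\<And>i. i \<in> A \<Longrightarrow> x \<le> ennreal c * f i"
  shows "x \<le> ennreal c * (INF i\<in>A. f i)"
proof -
  have "x / ennreal c \<le> (INF i\<in>A. f i)"
    using assms by (intro INF_greatest divide_le_posI_ennreal) auto
  then have "ennreal c * (x / ennreal c) \<le> ennreal c * (INF i\<in>A. f i)"
    by (rule mult_left_mono) simp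
  moreover have "ennreal c * (x / ennreal c) = x"
    using assms(1) mult_divide_eq_ennreal[of "ennreal c" x]
    by (simp add: ennreal_times_divide mult.commute)
  ultimately show ?thesis by simp
qed

section \<open>A convex potential on remaining sizes\<close>

text \<open>The truncated subtraction is intended: the potential ignores levels at which \<open>b\<close> is ahead.\<close>

definition level_gap :: "'i set \<Rightarrow> ('i \<Rightarrow> real) \<Rightarrow> ('i \<Rightarrow> real) \<Rightarrow> real \<Rightarrow> nat" where
  "level_gap X a b q = card {i \<in> X. q \<le> a i} - card {i \<in> X. q \<le> b i}"

definition level_potential ::
  "(nat \<Rightarrow> real) \<Rightarrow> 'i set \<Rightarrow> ('i \<Rightarrow> real) \<Rightarrow> ('i \<Rightarrow> real) \<Rightarrow> real" where
  "level_potential w X a b = (LINT q:{0<..}|lborel. \<Sum>j\<le>level_gap X a b q. w j)"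

lemma level_gap_le_card: "finite X \<Longrightarrow> level_gap X a b q \<le> card X"
  unfolding level_gap_def by (intro order_trans[OF diff_le_self] card_mono) auto

lemma level_gap_restrict:
  assumes "finite X" "R \<subseteq> X" "\<And>i. i \<in> X - R \<Longrightarrow> a i = b i"
  shows "level_gap X a b q = level_gap R a b q"
proof -
  have "card {i \<in> X. q \<le> c i} = card {i \<in> R. q \<le> c i} + card {i \<in> X - R. q \<le> c i}"
    for c :: "'a \<Rightarrow> real"
    using assms(1,2) by (subst card_Un_disjoint[symmetric])
      (auto intro: finite_subset arg_cong[where f = card])
  moreover have "{i \<in> X - R. q \<le> a i} = {i \<in> X - R. q \<le> b i}" using assms(3) by auto
  ultimately show ?thesis by (simp add: level_gap_def)
qed

lemma card_level_measurable [measurable]: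
  fixes a :: "'i \<Rightarrow> real"
  assumes "finite X"
  shows "(\<lambda>q. card {i \<in> X. q \<le> a i}) \<in> borel \<rightarrow>\<^sub>M count_space UNIV"
  using assms
proof (induction X)
  case (insert x X)
  let ?c = "\<lambda>q. card {i \<in> X. q \<le> a i}"
  have "card {i \<in> insert x X. q \<le> a i} = (if q \<le> a x then Suc (?c q) else ?c q)" for q
  proof (cases "q \<le> a x")
    case True
    then have "{i \<in> insert x X. q \<le> a i} = insert x {i \<in> X. q \<le> a i}" by auto
    then show ?thesis using True insert.hyps by simp
  next
    case False
    then have "{i \<in> insert x X. q \<le> a i} = {i \<in> X. q \<le> a i}" by auto
    then show ?thesis using False by simp
  qed
  moreover have "(\<lambda>q. if q \<le> a x then Suc (?c q) else ?c q) \<in> borel \<rightarrow>\<^sub>M count_space UNIV"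
    by (intro measurable_If measurable_compose[OF insert.IH]) (simp_all flip: atMost_def)
  ultimately show ?case by simp
qed simp

lemma card_level_diff:
  fixes a a' :: "'i \<Rightarrow> real"
  assumes "finite X" "\<And>i. i \<in> X \<Longrightarrow> a' i \<le> a i"
  shows "real (card {i \<in> X. q \<le> a i}) - real (card {i \<in> X. q \<le> a' i})
    = (\<Sum>i\<in>X. indicator {a' i<..a i} q)"
proof -
  have "real (card {i \<in> X. q \<le> c i}) = (\<Sum>i\<in>X. indicator {..c i} q)" for c
    using assms(1) by (simp add: indicator_def of_bool_def sum.If_cases Int_def)
  moreover have "indicator {..a i} q - indicator {..a' i} q = (indicator {a' i<..a i} q :: real)"
    if "i \<in> X" for i
    using assms(2)[OF that] by (auto split: split_indicator)
  ultimately show ?thesis by (simp flip: sum_subtractf)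
qed

lemma interval_indicator_integrable:
  fixes l u c :: real
  assumes "A \<in> sets borel"
  shows "set_integrable lborel A (\<lambda>q. c * indicator {l<..u} q)"
  unfolding set_integrable_def using assms
  by (intro integrable_mult_indicator integrable_mult_right integrable_real_indicator)
     (auto simp: emeasure_bounded_finite[unfolded infinity_ennreal_def])

context
  fixes w :: "nat \<Rightarrow> real" and X :: "'i set"
  assumes mono_w: "mono w" and w_0: "w 0 = 0" and finite_X: "finite X"
begin

lemma slope_nonneg: "0 \<le> w j"
  using monoD[OF mono_w, of 0 j] w_0 by simp

lemma cumulative_slope_mono: "m \<le> n \<Longrightarrow> sum w {..m} \<le> sum w {..n}"
  using slope_nonneg by (intro sum_mono2) auto

lemma cumulative_slope_increase_le:
  assumes "q' \<le> q" "p - q' \<le> N"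
  shows "sum w {..p - q'} \<le> sum w {..p - q} + w N * (real q - real q')"
proof -
  have "sum w {..p - q'} = sum w {..p - q} + sum w {p - q<..p - q'}"
    using assms by (subst sum.union_disjoint[symmetric]) (auto intro: arg_cong[where f = "sum w"])
  also have "sum w {p - q<..p - q'} \<le> real (card {p - q<..p - q'}) * w N"
    using assms by (intro sum_bounded_above) (auto intro: monoD[OF mono_w])
  also have "\<dots> \<le> (real q - real q') * w N"
    using assms slope_nonneg by (intro mult_right_mono) auto
  finally show ?thesis by (simp add: mult.commute)
qed

lemma cumulative_slope_decrease_ge:
  assumes "p' < p" "k \<le> p - q"
  shows "sum w {..p' - q} \<le> sum w {..p - q} - w k"
proof (cases "p - q")
  case 0
  then show ?thesis using assms w_0 by simp
next
  case (Suc n)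
  have "sum w {..p' - q} \<le> sum w {..n}"
    using assms Suc by (intro cumulative_slope_mono) auto
  moreover have "w k \<le> w (Suc n)" using assms Suc by (intro monoD[OF mono_w]) simp
  ultimately show ?thesis using Suc by simp
qed

lemma level_potential_integrable:
  "set_integrable lborel {0<..} (\<lambda>q. \<Sum>j\<le>level_gap X a b q. w j)"
  unfolding set_integrable_def
proof (rule integrableI_bounded_set)
  let ?A = "{0<..Max (insert 0 (a ` X))}"
  let ?f = "\<lambda>q. indicator {0<..} q *\<^sub>R (\<Sum>j\<le>level_gap X a b q. w j)"
  show "?A \<in> sets lborel" "emeasure lborel ?A < \<infinity>"
    using emeasure_bounded_finite[of ?A] by auto
  show "?f \<in> borel_measurable lborel"
    unfolding level_gap_def using finite_X by measurable
  have "sum w {..level_gap X a b q} \<le> sum w {..card X}" for q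
    using level_gap_le_card[OF finite_X] by (rule cumulative_slope_mono)
  then show "AE q in lborel. q \<in> ?A \<longrightarrow> norm (?f q) \<le> sum w {..card X}"
    using slope_nonneg by (intro AE_I2) (auto simp: sum_nonneg)
  have "?f q = 0" if "q \<notin> ?A" for q
  proof (cases "0 < q")
    case True
    then have "Max (insert 0 (a ` X)) < q" using \<open>q \<notin> ?A\<close> by simp
    moreover have "a i \<le> Max (insert 0 (a ` X))" if "i \<in> X" for i
      using that finite_X by (intro Max_ge) auto
    ultimately have no_level: "{i \<in> X. q \<le> a i} = {}" by force
    show ?thesis unfolding level_gap_def no_level by (simp add: w_0)
  qed simp
  then show "AE q in lborel. q \<notin> ?A \<longrightarrow> ?f q = 0" by simp
qed

lemma level_potential_nonneg: "0 \<le> level_potential w X a b"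
  unfolding level_potential_def set_lebesgue_integral_def
  by (intro integral_nonneg_AE AE_I2) (auto simp: sum_nonneg slope_nonneg)

lemma level_potential_same: "(\<And>i. i \<in> X \<Longrightarrow> a i = b i) \<Longrightarrow> level_potential w X a b = 0"
  using level_gap_restrict[OF finite_X, of "{}" a b] w_0
  by (simp add: level_potential_def level_gap_def)

lemma level_potential_mono_first:
  assumes "\<And>i. i \<in> X \<Longrightarrow> a' i \<le> a i"
  shows "level_potential w X a' b \<le> level_potential w X a b"
proof -
  have "level_gap X a' b q \<le> level_gap X a b q" for q
    unfolding level_gap_def using finite_X assms by (intro diff_le_mono card_mono) force+
  then show ?thesis
    unfolding level_potential_def
    by (intro set_integral_mono level_potential_integrable cumulative_slope_mono)
qed

lemma level_potential_lower_second:
  assumes b: "\<And>i. i \<in> X \<Longrightarrow> b' i \<le> b i"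
    and N: "\<And>q. 0 < q \<Longrightarrow> level_gap X a b' q \<le> N"
  shows "level_potential w X a b' \<le> level_potential w X a b + w N * (\<Sum>i\<in>X. b i - b' i)"
proof -
  let ?h = "\<lambda>q. \<Sum>i\<in>X. w N * indicator {b' i<..b i} q :: real"
  have int_h: "set_integrable lborel {0<..} ?h"
    unfolding set_integrable_def scaleR_sum_right
    by (intro Bochner_Integration.integrable_sum
        interval_indicator_integrable[unfolded set_integrable_def]) simp
  have pointwise: "(\<Sum>j\<le>level_gap X a b' q. w j) \<le> (\<Sum>j\<le>level_gap X a b q. w j) + ?h q" if "0 < q" for q
  proof -
    have "card {i \<in> X. q \<le> b' i} \<le> card {i \<in> X. q \<le> b i}"
      using b finite_X by (intro card_mono) force+
    from cumulative_slope_increase_le[OF this N[OF that, unfolded level_gap_def]] show ?thesis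
      using card_level_diff[OF finite_X, of b' b q] b by (simp add: level_gap_def sum_distrib_left)
  qed
  have "level_potential w X a b' \<le> (LINT q:{0<..}|lborel. (\<Sum>j\<le>level_gap X a b q. w j) + ?h q)"
    unfolding level_potential_def using int_h pointwise
    by (intro set_integral_mono set_integral_add level_potential_integrable) auto
  also have "\<dots> = level_potential w X a b + (LINT q:{0<..}|lborel. ?h q)"
    unfolding level_potential_def using int_h by (intro set_integral_add level_potential_integrable)
  also have "(LINT q:{0<..}|lborel. ?h q)
      = (\<Sum>i\<in>X. LINT q:{0<..}|lborel. w N * indicator {b' i<..b i} q)"
    unfolding set_lebesgue_integral_def scaleR_sum_right
    by (intro Bochner_Integration.integral_sum
        interval_indicator_integrable[unfolded set_integrable_def]) simp
  also have "\<dots> \<le> (\<Sum>i\<in>X. w N * (b i - b' i))"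
  proof (rule sum_mono)
    fix i assume i: "i \<in> X"
    have "(LINT q:{0<..}|lborel. w N * indicator {b' i<..b i} q)
        \<le> (LINT q|lborel. w N * indicator {b' i<..b i} q)"
      unfolding set_lebesgue_integral_def
      using slope_nonneg interval_indicator_integrable[of UNIV]
        interval_indicator_integrable[of "{0<..}"]
      by (intro integral_mono) (auto simp: set_integrable_def split: split_indicator)
    also have "\<dots> = w N * (b i - b' i)"
      using b[OF i] by simp
    finally show "(LINT q:{0<..}|lborel. w N * indicator {b' i<..b i} q) \<le> w N * (b i - b' i)" .
  qed
  finally show ?thesis by (simp add: sum_distrib_left)
qed

lemma level_potential_lower_first:
  assumes a: "\<And>i. i \<in> X \<Longrightarrow> a' i \<le> a i"
    and x: "x \<in> X" "0 \<le> a' x"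
    and k: "\<And>q. 0 < q \<Longrightarrow> q \<le> a x \<Longrightarrow> k \<le> level_gap X a b q"
  shows "level_potential w X a' b \<le> level_potential w X a b - w k * (a x - a' x)"
proof -
  let ?h = "\<lambda>q. w k * indicator {a' x<..a x} q :: real"
  have pointwise: "(\<Sum>j\<le>level_gap X a' b q. w j) \<le> (\<Sum>j\<le>level_gap X a b q. w j) - ?h q" if "0 < q" for q
  proof (cases "q \<in> {a' x<..a x}")
    case True
    then have "{i \<in> X. q \<le> a' i} \<subset> {i \<in> X. q \<le> a i}" using a x by force
    then have "card {i \<in> X. q \<le> a' i} < card {i \<in> X. q \<le> a i}"
      using finite_X by (intro psubset_card_mono) auto
    from cumulative_slope_decrease_ge[OF this] show ?thesis
      using True k[OF that] by (simp add: level_gap_def)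
  next
    case False
    have "level_gap X a' b q \<le> level_gap X a b q"
      unfolding level_gap_def using finite_X a by (intro diff_le_mono card_mono) force+
    then show ?thesis using False cumulative_slope_mono by simp
  qed
  have "level_potential w X a' b \<le> (LINT q:{0<..}|lborel. (\<Sum>j\<le>level_gap X a b q. w j) - ?h q)"
    unfolding level_potential_def using pointwise
    by (intro set_integral_mono set_integral_diff level_potential_integrable
        interval_indicator_integrable) auto
  also have "\<dots> = level_potential w X a b - (LINT q:{0<..}|lborel. ?h q)"
    unfolding level_potential_def
    by (intro set_integral_diff level_potential_integrable interval_indicator_integrable) simp
  also have "(LINT q:{0<..}|lborel. ?h q) = (LINT q|lborel. ?h q)"
    unfolding set_lebesgue_integral_def
    using x(2) by (intro Bochner_Integration.integral_cong) (auto split: split_indicator)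
  also have "\<dots> = w k * (a x - a' x)" using a[OF x(1)] by simp
  finally show ?thesis .
qed

lemma level_potential_increase_le:
  assumes "\<And>i. i \<in> X \<Longrightarrow> a' i \<le> a i" "\<And>i. i \<in> X \<Longrightarrow> b' i \<le> b i"
  shows "level_potential w X a' b' - level_potential w X a b \<le> w (card X) * (\<Sum>i\<in>X. b i - b' i)"
  using level_potential_mono_first[of a' a b'] level_potential_lower_second[of b' b a "card X"]
    level_gap_le_card[OF finite_X] assms by fastforce

end

context
  fixes w :: "nat \<Rightarrow> real" and X R :: "'i set" and a b :: "'i \<Rightarrow> real \<Rightarrow> real" and t :: real
  assumes w: "mono w" "w 0 = 0" and X: "finite X" "R \<subseteq> X"
    and antimono_a: "\<And>i. i \<in> X \<Longrightarrow> antimono (a i)" and antimono_b: "\<And>i. i \<in> X \<Longrightarrow> antimono (b i)"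
    and outside: "\<And>i. i \<in> X - R \<Longrightarrow> \<forall>\<^sub>F u in at_right t. b i u = a i t"
begin

lemma eventually_level_gap:
  "\<forall>\<^sub>F u in at_right t. t < u \<and> (\<forall>q. level_gap X (\<lambda>i. a i t) (\<lambda>i. b i u) q
    = card {i \<in> R. q \<le> a i t} - card {i \<in> R. q \<le> b i u})"
proof -
  have "\<forall>\<^sub>F u in at_right t. \<forall>i\<in>X - R. b i u = a i t"
    using X outside by (intro eventually_ball_finite) auto
  then show ?thesis
    using eventually_at_right_less[of t]
  proof eventually_elim
    case (elim u)
    then show ?case
      using level_gap_restrict[OF X, of "\<lambda>i. a i t" "\<lambda>i. b i u"] by (simp add: level_gap_def)
  qed
qed

lemma eventually_level_potential_lower_second:
  assumes n: "card {i \<in> R. 0 < a i t} \<le> n"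
  shows "\<forall>\<^sub>F u in at_right t. level_potential w X (\<lambda>i. a i t) (\<lambda>i. b i u)
    \<le> level_potential w X (\<lambda>i. a i t) (\<lambda>i. b i t) + w n * (\<Sum>i\<in>X. b i t - b i u)"
  using eventually_level_gap
proof eventually_elim
  case (elim u)
  show ?case
  proof (rule level_potential_lower_second[OF w X(1)])
    show "b i u \<le> b i t" if "i \<in> X" for i using antimonoD[OF antimono_b[OF that]] elim by simp
    fix q :: real assume "0 < q"
    then have "card {i \<in> R. q \<le> a i t} \<le> card {i \<in> R. 0 < a i t}"
      using finite_subset[OF X(2,1)] by (intro card_mono) auto
    then show "level_gap X (\<lambda>i. a i t) (\<lambda>i. b i u) q \<le> n" using n elim by simp
  qed
qed

lemma eventually_level_potential_lower_first:
  assumes x: "x \<in> X" "0 < a x t" "(a x has_real_derivative d) (at_right t)"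
    and k: "k + card {i \<in> R. 0 < b i t} \<le> card {i \<in> R. a x t \<le> a i t}"
  shows "\<forall>\<^sub>F u in at_right t. level_potential w X (\<lambda>i. a i u) (\<lambda>i. b i u)
    \<le> level_potential w X (\<lambda>i. a i t) (\<lambda>i. b i u) - w k * (a x t - a x u)"
  using eventually_level_gap eventually_pos_at_right[OF x(3,2)]
proof eventually_elim
  case (elim u)
  show ?case
  proof (rule level_potential_lower_first[OF w X(1) _ x(1)])
    show "a i u \<le> a i t" if "i \<in> X" for i using antimonoD[OF antimono_a[OF that]] elim by simp
    show "0 \<le> a x u" using elim by simp
    fix q :: real assume "0 < q" "q \<le> a x t"
    then have "card {i \<in> R. a x t \<le> a i t} \<le> card {i \<in> R. q \<le> a i t}"
      using finite_subset[OF X(2,1)] by (intro card_mono) auto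
    moreover have "card {i \<in> R. q \<le> b i u} \<le> card {i \<in> R. 0 < b i t}"
    proof (intro card_mono subsetI)
      fix i assume i: "i \<in> {i \<in> R. q \<le> b i u}"
      then have "b i u \<le> b i t" using antimonoD[OF antimono_b, of i t u] elim X by auto
      then show "i \<in> {i \<in> R. 0 < b i t}" using i \<open>0 < q\<close> by simp
    qed (use finite_subset[OF X(2,1)] in simp)
    ultimately show "k \<le> level_gap X (\<lambda>i. a i t) (\<lambda>i. b i u) q" using k elim by simp
  qed
qed

lemma level_potential_dini:
  assumes n: "card {i \<in> R. 0 < a i t} \<le> n"
    and b_deriv: "\<And>i. i \<in> X \<Longrightarrow> (b i has_real_derivative - v i) (at_right t)"
    and served: "k > 0 \<Longrightarrow> x \<in> X \<and> 0 < a x t \<and> (a x has_real_derivative - \<mu>) (at_right t) \<and>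
      k + card {i \<in> R. 0 < b i t} \<le> card {i \<in> R. a x t \<le> a i t}"
  shows "dini_le (\<lambda>u. level_potential w X (\<lambda>i. a i u) (\<lambda>i. b i u)) t (w n * sum v X - w k * \<mu>)"
proof -
  let ?P = "\<lambda>u v. level_potential w X (\<lambda>i. a i u) (\<lambda>i. b i v)"
  let ?bound = "\<lambda>u. ?P t t + w n * (\<Sum>i\<in>X. b i t - b i u) - w k * (a x t - a x u)"
  have "\<forall>\<^sub>F u in at_right t. ?P u u \<le> ?P t u - w k * (a x t - a x u)"
  proof (cases "k > 0")
    case True
    then show ?thesis using served eventually_level_potential_lower_first by blast
  next
    case False
    have "\<forall>\<^sub>F u in at_right t. ?P u u \<le> ?P t u"
      using eventually_at_right_less[of t]
    proof eventually_elim
      case (elim u)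
      then show ?case
        by (intro level_potential_mono_first[OF w X(1)] antimonoD[OF antimono_a]) auto
    qed
    then show ?thesis using False w(2) by simp
  qed
  with eventually_level_potential_lower_second[OF n]
  have bound: "\<forall>\<^sub>F u in at_right t. ?P u u \<le> ?bound u"
    by eventually_elim simp
  have "((\<lambda>u. w k * (a x t - a x u)) has_real_derivative w k * \<mu>) (at_right t)"
    using served w(2) by (cases "k > 0") (auto intro!: derivative_eq_intros)
  moreover have "((\<lambda>u. b i t - b i u) has_real_derivative v i) (at_right t)" if "i \<in> X" for i
    using DERIV_diff[OF DERIV_const b_deriv[OF that], of "b i t"] by simp
  then have "((\<lambda>u. w n * (\<Sum>i\<in>X. b i t - b i u)) has_real_derivative w n * sum v X) (at_right t)"
    by (intro DERIV_cmult DERIV_sum)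
  ultimately have "(?bound has_real_derivative 0 + w n * sum v X - w k * \<mu>) (at_right t)"
    by (intro DERIV_diff DERIV_add DERIV_const)
  then have "dini_le ?bound t (w n * sum v X - w k * \<mu>)"
    using dini_le_if_has_real_derivative by simp
  then show ?thesis using bound by (rule dini_le_if_eventually_le) simp
qed

end

section \<open>Power inequalities\<close>

lemma Youngs_inequality_powr:
  fixes \<alpha> s z :: real
  assumes "1 < \<alpha>" "0 \<le> s" "0 \<le> z"
  shows "\<alpha> * z powr (1 - 1 / \<alpha>) * s \<le> s powr \<alpha> + (\<alpha> - 1) * z"
proof -
  define q where "q = \<alpha> / (\<alpha> - 1)"
  have q: "q > 1" "1 / \<alpha> + 1 / q = 1" "1 - 1 / \<alpha> = 1 / q"
    using assms by (auto simp: q_def field_simps)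
  have "s * z powr (1 / q) \<le> s powr \<alpha> / \<alpha> + (z powr (1 / q)) powr q / q"
    using assms q by (intro Youngs_inequality) auto
  also have "(z powr (1 / q)) powr q = z"
    using q assms by (simp add: powr_powr)
  finally have "\<alpha> * (s * z powr (1 / q)) \<le> \<alpha> * (s powr \<alpha> / \<alpha> + z / q)"
    using assms by (intro mult_left_mono) auto
  also have "\<dots> = s powr \<alpha> + (\<alpha> - 1) * z"
    using assms by (simp add: q_def field_simps)
  finally show ?thesis by (simp add: q mult_ac)
qed

lemma sum_powr_le:
  fixes f :: "'a \<Rightarrow> real"
  assumes "1 < p" "finite A" "\<And>i. i \<in> A \<Longrightarrow> 0 \<le> f i"
  shows "(\<Sum>i\<in>A. f i) powr p \<le> real (card A) powr (p - 1) * (\<Sum>i\<in>A. f i powr p)"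
proof (cases "A = {}")
  case False
  define n where "n = real (card A)"
  define M where "M = (\<Sum>i\<in>A. f i) / n"
  have n: "0 < n" using False assms by (simp add: n_def card_gt_0_iff)
  have M: "0 \<le> M" using assms n by (simp add: M_def sum_nonneg)
  have "M powr (p - 1) * M = M powr p"
    using M by (cases "M = 0") (auto simp: powr_diff)
  have "p * M powr (p - 1) * f i \<le> f i powr p + (p - 1) * M powr p" if "i \<in> A" for i
    using Youngs_inequality_powr[of p "f i" "M powr p"] assms that
    by (simp add: powr_powr right_diff_distrib)
  then have "(\<Sum>i\<in>A. p * M powr (p - 1) * f i) \<le> (\<Sum>i\<in>A. f i powr p + (p - 1) * M powr p)"
    by (rule sum_mono)
  also have "(\<Sum>i\<in>A. p * M powr (p - 1) * f i) = n * (p * (M powr (p - 1) * M))"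
    using n by (simp add: M_def sum_distrib_left[symmetric])
  finally have "n * (p * M powr p) \<le> (\<Sum>i\<in>A. f i powr p) + n * ((p - 1) * M powr p)"
    using \<open>M powr (p - 1) * M = M powr p\<close> by (simp add: sum.distrib n_def)
  then have "n * M powr p \<le> (\<Sum>i\<in>A. f i powr p)" by (simp add: algebra_simps)
  then have "n powr (p - 1) * (n * M powr p) \<le> n powr (p - 1) * (\<Sum>i\<in>A. f i powr p)"
    by (rule mult_left_mono) simp
  moreover have "n powr (p - 1) * (n * M powr p) = (n * M) powr p"
    using n M by (simp add: powr_mult powr_diff)
  moreover have "n * M = (\<Sum>i\<in>A. f i)" using n by (simp add: M_def)
  ultimately show ?thesis by (simp add: n_def)
qed simp

section \<open>A race between two families of residuals\<close>

definition weight :: "real \<Rightarrow> real \<Rightarrow> nat \<Rightarrow> real" where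
  "weight \<alpha> c k = \<alpha> * (c * real k) powr (1 - 1 / \<alpha>)"

lemma weight_0 [simp]: "weight \<alpha> c 0 = 0"
  by (simp add: weight_def)

lemma mono_weight: "1 < \<alpha> \<Longrightarrow> 0 \<le> c \<Longrightarrow> mono (weight \<alpha> c)"
  unfolding weight_def by (intro monoI mult_left_mono powr_mono2) auto

lemma weight_nonneg: "1 < \<alpha> \<Longrightarrow> 0 \<le> weight \<alpha> c k"
  by (simp add: weight_def)

lemma weight_speed_le:
  assumes "1 < \<alpha>" "0 \<le> s" "0 \<le> c"
  shows "weight \<alpha> c n * s \<le> s powr \<alpha> + (\<alpha> - 1) * (c * real n)"
  unfolding weight_def using assms by (intro Youngs_inequality_powr) auto

lemma weight_speed_ge:
  assumes "1 < \<alpha>" "0 \<le> c" "k \<le> m" "(c * real m + 1) powr (1 / \<alpha>) \<le> \<mu>"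
  shows "\<alpha> * (c * real k) \<le> weight \<alpha> c k * \<mu>"
proof -
  have "c * real k \<le> c * real m" using assms by (intro mult_left_mono) auto
  then have "(c * real k) powr (1 / \<alpha>) \<le> (c * real m + 1) powr (1 / \<alpha>)"
    using assms by (intro powr_mono2) auto
  then have "(c * real k) powr (1 / \<alpha>) \<le> \<mu>" using assms(4) by linarith
  have "c * real k = (c * real k) powr (1 - 1 / \<alpha>) * (c * real k) powr (1 / \<alpha>)"
    using assms by (simp add: powr_add[symmetric])
  also have "\<dots> \<le> (c * real k) powr (1 - 1 / \<alpha>) * \<mu>"
    using \<open>(c * real k) powr (1 / \<alpha>) \<le> \<mu>\<close> by (intro mult_left_mono) auto
  finally have "\<alpha> * (c * real k) \<le> \<alpha> * ((c * real k) powr (1 - 1 / \<alpha>) * \<mu>)"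
    using assms by (intro mult_left_mono) auto
  then show ?thesis by (simp add: weight_def mult.assoc)
qed

lemma weight_drift_le:
  assumes "1 < \<alpha>" "0 \<le> c" "v \<le> s" "0 \<le> s" and \<mu>: "m' < m \<Longrightarrow> (c * real m + 1) powr (1 / \<alpha>) \<le> \<mu>"
  shows "weight \<alpha> c n * v - weight \<alpha> c (m - m') * \<mu>
    \<le> s powr \<alpha> + (\<alpha> - 1) * (c * real n) - \<alpha> * (c * real m) + \<alpha> * (c * real m')"
proof -
  have "weight \<alpha> c n * v \<le> weight \<alpha> c n * s"
    using assms weight_nonneg by (intro mult_left_mono)
  also have "\<dots> \<le> s powr \<alpha> + (\<alpha> - 1) * (c * real n)"
    using assms by (intro weight_speed_le)
  finally have "weight \<alpha> c n * v \<le> s powr \<alpha> + (\<alpha> - 1) * (c * real n)" .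
  moreover have "\<alpha> * (c * real (m - m')) \<le> weight \<alpha> c (m - m') * \<mu>"
    using weight_speed_ge[OF assms(1,2), of "m - m'" m \<mu>] \<mu> by (cases "m' < m") simp_all
  moreover have "\<alpha> * (c * (real m - real m')) \<le> \<alpha> * (c * real (m - m'))"
    using assms by (intro mult_left_mono) auto
  ultimately show ?thesis by (simp add: algebra_simps)
qed

locale residual_race =
  fixes X :: "'i set" and release_time :: "'i \<Rightarrow> real" and a b :: "'i \<Rightarrow> real \<Rightarrow> real"
    and \<alpha> c :: real
  assumes finite_X: "finite X" and exponent: "1 < \<alpha>" and c_nonneg: "0 \<le> c"
    and antimono_a: "i \<in> X \<Longrightarrow> antimono (a i)" and antimono_b: "i \<in> X \<Longrightarrow> antimono (b i)"
    and before_release: "\<lbrakk>i \<in> X; t < release_time i; u < release_time i\<rbrakk> \<Longrightarrow> a i t = b i u"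
begin

definition potential :: "real \<Rightarrow> real" where
  "potential t = level_potential (weight \<alpha> c) X (\<lambda>i. a i t) (\<lambda>i. b i t)"

lemma mono_slope: "mono (weight \<alpha> c)"
  using exponent c_nonneg by (rule mono_weight)

lemma potential_nonneg: "0 \<le> potential t"
  unfolding potential_def by (rule level_potential_nonneg[OF mono_slope weight_0 finite_X])

lemma potential_before_release:
  assumes "\<And>i. i \<in> X \<Longrightarrow> t < release_time i"
  shows "potential t = 0"
  unfolding potential_def
  by (rule level_potential_same[OF mono_slope weight_0 finite_X]) (intro before_release assms)

lemma potential_increase_le:
  assumes "t \<le> u"
  shows "potential u - potential t \<le> weight \<alpha> c (card X) * (\<Sum>i\<in>X. b i t - b i u)"
  unfolding potential_def
  by (rule level_potential_increase_le[OF mono_slope weight_0 finite_X])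
     (use assms antimonoD[OF antimono_a] antimonoD[OF antimono_b] in blast)+

lemma potential_dini:
  assumes b_deriv: "\<And>i. i \<in> X \<Longrightarrow> (b i has_real_derivative - v i) (at_right t)"
    and s: "sum v X \<le> s" "0 \<le> s"
    and n: "card {i \<in> X. release_time i \<le> t \<and> 0 < a i t} \<le> n"
    and U: "U \<subseteq> {i \<in> X. release_time i \<le> t \<and> 0 < a i t}"
    and served: "U \<noteq> {} \<Longrightarrow> \<exists>x\<in>U. (\<forall>y\<in>U. a x t \<le> a y t) \<and>
      (\<exists>\<mu> \<ge> (c * real (card U) + 1) powr (1 / \<alpha>). (a x has_real_derivative - \<mu>) (at_right t))"
  shows "dini_le potential t (s powr \<alpha> + (\<alpha> - 1) * (c * real n) - \<alpha> * (c * real (card U))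
    + \<alpha> * (c * real (card {i \<in> X. release_time i \<le> t \<and> 0 < b i t})))"
proof -
  define m where "m = card U"
  define m' where "m' = card {i \<in> X. release_time i \<le> t \<and> 0 < b i t}"
  let ?R = "{i \<in> X. release_time i \<le> t}"
  let ?w = "weight \<alpha> c"
  obtain x \<mu> where x: "m' < m \<Longrightarrow> x \<in> U \<and> (\<forall>y\<in>U. a x t \<le> a y t)
      \<and> (c * real m + 1) powr (1 / \<alpha>) \<le> \<mu> \<and> (a x has_real_derivative - \<mu>) (at_right t)"
  proof (cases "U = {}")
    case False
    then show ?thesis using served that unfolding m_def by blast
  qed (use that in \<open>auto simp: m_def\<close>)
  have "dini_le potential t (?w n * sum v X - ?w (m - m') * \<mu>)"
    unfolding potential_def
  proof (rule level_potential_dini[where R = ?R])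
    show "\<forall>\<^sub>F u in at_right t. b i u = a i t" if "i \<in> X - ?R" for i
    proof -
      have "t < release_time i" using that by (simp add: not_le)
      then show ?thesis
        unfolding eventually_at_right_field using that before_release[of i]
        by (intro exI[of _ "release_time i"]) auto
    qed
    show "x \<in> X \<and> 0 < a x t \<and> (a x has_real_derivative - \<mu>) (at_right t) \<and>
        m - m' + card {i \<in> ?R. 0 < b i t} \<le> card {i \<in> ?R. a x t \<le> a i t}" if "0 < m - m'"
    proof -
      have "m \<le> card {i \<in> ?R. a x t \<le> a i t}"
        unfolding m_def using x that U finite_X by (intro card_mono) auto
      then show ?thesis using x that U by (auto simp: m'_def)
    qed
  qed (use mono_slope finite_X antimono_a antimono_b b_deriv n in auto)
  moreover have "?w n * sum v X - ?w (m - m') * \<mu>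
      \<le> s powr \<alpha> + (\<alpha> - 1) * (c * real n) - \<alpha> * (c * real m) + \<alpha> * (c * real m')"
    using exponent c_nonneg s x by (intro weight_drift_le) auto
  ultimately show ?thesis unfolding m_def m'_def by (rule dini_le_mono)
qed

end

section \<open>Schedules of a MapReduce instance\<close>

definition map_tasks :: "mrinst \<Rightarrow> task set" where
  "map_tasks I = {x \<in> tasks I. is_map x}"

definition reduce_tasks :: "mrinst \<Rightarrow> task set" where
  "reduce_tasks I = {x \<in> tasks I. \<not> is_map x}"

definition ureds :: "mrinst \<Rightarrow> schedule \<Rightarrow> real \<Rightarrow> task set" where
  "ureds I S t = {x. unfinished I S x t \<and> \<not> is_map x}"

text \<open>The truncation matters: a feasible schedule may keep processing a finished task, which makes
  its \<open>rem\<close> negative.\<close>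

definition job_rem :: "mrinst \<Rightarrow> schedule \<Rightarrow> nat \<Rightarrow> real \<Rightarrow> real" where
  "job_rem I S i t = (\<Sum>k<nmap I i. max 0 (rem I S (MapT i k) t))"

definition job_speed :: "mrinst \<Rightarrow> schedule \<Rightarrow> nat \<Rightarrow> real \<Rightarrow> real" where
  "job_speed I S i t = (\<Sum>k<nmap I i. if 0 < rem I S (MapT i k) t then S (MapT i k) t else 0)"

definition speed :: "mrinst \<Rightarrow> schedule \<Rightarrow> real \<Rightarrow> real" where
  "speed I S t = (\<Sum>x\<in>tasks I. S x t)"

definition cost_rate :: "mrinst \<Rightarrow> real \<Rightarrow> schedule \<Rightarrow> real \<Rightarrow> real" where
  "cost_rate I \<alpha> S t = real (card {x. unfinished I S x t}) + speed I S t powr \<alpha>"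

lemma cost_eq: "cost I \<alpha> S = (\<integral>\<^sup>+t. ennreal (cost_rate I \<alpha> S t) \<partial>lborel)"
  by (simp add: cost_def cost_rate_def speed_def)

lemma cost_rate_nonneg: "0 \<le> cost_rate I \<alpha> S t"
  by (simp add: cost_rate_def)

lemma map_tasks_eq: "map_tasks I = (\<lambda>(i, k). MapT i k) ` (SIGMA i:{..<njobs I}. {..<nmap I i})"
  by (auto simp: map_tasks_def tasks_def image_iff)

lemma reduce_tasks_eq: "reduce_tasks I = (\<lambda>(i, k). RedT i k) ` ({..<njobs I} \<times> {..<nred I})"
  by (auto simp: reduce_tasks_def tasks_def image_iff)

lemma tasks_eq: "tasks I = map_tasks I \<union> reduce_tasks I"
  and map_reduce_disjoint: "map_tasks I \<inter> reduce_tasks I = {}"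
  by (auto simp: map_tasks_def reduce_tasks_def)

lemma finite_map_tasks [simp]: "finite (map_tasks I)"
  and finite_reduce_tasks [simp]: "finite (reduce_tasks I)"
  and finite_tasks [simp]: "finite (tasks I)"
  by (simp_all add: map_tasks_eq reduce_tasks_eq tasks_eq)

lemma MapT_in_tasks [simp]: "MapT i k \<in> tasks I \<longleftrightarrow> i < njobs I \<and> k < nmap I i"
  and RedT_in_tasks [simp]: "RedT i k \<in> tasks I \<longleftrightarrow> i < njobs I \<and> k < nred I"
  by (auto simp: tasks_def)

lemma map_tasks_subset: "map_tasks I \<subseteq> tasks I" and reduce_tasks_subset: "reduce_tasks I \<subseteq> tasks I"
  by (auto simp: tasks_eq)

lemma release_simps [simp]: "release I (MapT i k) = rel I i" "release I (RedT i k) = rel I i"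
  by (auto simp: release_def)

lemma sum_tasks_split: "(\<Sum>x\<in>tasks I. f x) = (\<Sum>x\<in>map_tasks I. f x) + (\<Sum>x\<in>reduce_tasks I. f x)"
  by (simp add: tasks_eq sum.union_disjoint map_reduce_disjoint)

lemma sum_map_tasks: "(\<Sum>x\<in>map_tasks I. f x) = (\<Sum>i<njobs I. \<Sum>k<nmap I i. f (MapT i k))"
proof -
  have "(\<Sum>x\<in>map_tasks I. f x) = (\<Sum>(i, k)\<in>(SIGMA i:{..<njobs I}. {..<nmap I i}). f (MapT i k))"
    unfolding map_tasks_eq by (subst sum.reindex) (auto simp: inj_on_def case_prod_beta)
  then show ?thesis by (simp add: sum.Sigma)
qed

lemma is_done_mono: "is_done I S x t \<Longrightarrow> t \<le> u \<Longrightarrow> is_done I S x u"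
  unfolding is_done_def work_def
  by (erule order_trans) (intro nn_integral_mono mult_left_mono, auto split: split_indicator)

lemma rem_idle:
  assumes "\<And>u. u \<le> t \<Longrightarrow> S x u = 0"
  shows "rem I S x t = tsize I x"
proof -
  have "work S x t = (\<integral>\<^sup>+u. 0 \<partial>(lborel :: real measure))"
    unfolding work_def by (intro nn_integral_cong) (auto simp: assms split: split_indicator)
  then show ?thesis by (simp add: rem_def)
qed

lemma job_rem_pos_iff: "0 < job_rem I S i t \<longleftrightarrow> (\<exists>k<nmap I i. 0 < rem I S (MapT i k) t)"
proof -
  have "job_rem I S i t = 0 \<longleftrightarrow> (\<forall>k<nmap I i. rem I S (MapT i k) t \<le> 0)"
    unfolding job_rem_def by (subst sum_nonneg_eq_0_iff) (auto simp flip: max.absorb_iff1)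
  moreover have "0 \<le> job_rem I S i t" unfolding job_rem_def by (simp add: sum_nonneg)
  ultimately show ?thesis by (metis less_le not_le)
qed

lemma finite_unfinished [simp]: "finite {x. unfinished I S x t}"
  by (rule finite_subset[of _ "tasks I"]) (auto simp: unfinished_def)

lemma finite_umaps [simp]: "finite (umaps I S t)" and finite_ureds [simp]: "finite (ureds I S t)"
  and finite_freereds [simp]: "finite (freereds I S t)"
  by (rule finite_subset[OF _ finite_unfinished[of I S t]];
      auto simp: umaps_def ureds_def freereds_def)+

lemma finite_ajobs [simp]: "finite (ajobs I S t)"
  by (simp add: ajobs_def)

lemma ajobs_iff: "i \<in> ajobs I S t \<longleftrightarrow> (\<exists>k. unfinished I S (MapT i k) t)"
proof
  assume "i \<in> ajobs I S t"
  then obtain y where "unfinished I S y t" "is_map y" "job y = i"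
    by (auto simp: ajobs_def umaps_def)
  then show "\<exists>k. unfinished I S (MapT i k) t" by (cases y) auto
qed (force simp: ajobs_def umaps_def)

lemma card_unfinished_split: "card {x. unfinished I S x t} = card (umaps I S t) + card (ureds I S t)"
proof -
  have "{x. unfinished I S x t} = umaps I S t \<union> ureds I S t" "umaps I S t \<inter> ureds I S t = {}"
    by (auto simp: umaps_def ureds_def)
  then show ?thesis by (simp add: card_Un_disjoint)
qed

locale mr_run =
  fixes I :: mrinst and S :: schedule
  assumes valid: "valid_instance I" and feas: "feasible I S"
    and work_finite: "\<And>x t. x \<in> tasks I \<Longrightarrow> work S x t < \<infinity>"
begin

lemma S_measurable [measurable]: "S x \<in> borel_measurable borel"
  and S_nonneg: "0 \<le> S x t"
  and S_before_release: "t < release I x \<Longrightarrow> S x t = 0"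
  and S_reduce: "S (RedT i k) t \<noteq> 0 \<Longrightarrow> k' < nmap I i \<Longrightarrow> is_done I S (MapT i k') t"
  using feas by (auto simp: feasible_def)

lemma size_pos: "x \<in> tasks I \<Longrightarrow> 0 < tsize I x"
  using valid by (simp add: valid_instance_def)

lemma work_eq: "work S x t = (\<integral>\<^sup>+u. ennreal (indicator {..t} u * S x u) \<partial>lborel)"
  unfolding work_def by (intro nn_integral_cong) (auto split: split_indicator)

lemma S_integrable_atMost:
  assumes "x \<in> tasks I" shows "set_integrable lborel {..t} (S x)"
  unfolding set_integrable_def
  using work_finite[OF assms, of t] S_nonneg
  by (intro integrableI_nonneg) (auto simp: work_eq)

lemma S_integrable_Icc:
  assumes "x \<in> tasks I" shows "set_integrable lborel {t..u} (S x)"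
  by (rule set_integrable_subset[OF S_integrable_atMost[OF assms, of u]]) auto

lemma rem_eq:
  assumes "x \<in> tasks I" shows "rem I S x t = tsize I x - (LINT u:{..t}|lborel. S x u)"
proof -
  have "work S x t = ennreal (LINT u:{..t}|lborel. S x u)"
    using nn_integral_eq_set_integral[OF S_integrable_atMost[OF assms]] S_nonneg
    by (simp add: work_def)
  moreover have "0 \<le> (LINT u:{..t}|lborel. S x u)"
    using S_nonneg by (simp add: set_lebesgue_integral_def)
  ultimately show ?thesis by (simp add: rem_def)
qed

lemma rem_diff:
  assumes "x \<in> tasks I" "t \<le> u"
  shows "rem I S x t - rem I S x u = (LINT v:{t..u}|lborel. S x v)"
proof -
  have "(LINT v:{..t} \<union> {t..u}|lborel. S x v)
      = (LINT v:{..t}|lborel. S x v) + (LINT v:{t..u}|lborel. S x v)"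
    using AE_lborel_singleton[of t] S_integrable_atMost[OF assms(1)] S_integrable_Icc[OF assms(1)]
    by (intro set_integral_Un_AE) (auto elim: eventually_mono)
  moreover have "{..t} \<union> {t..u} = {..u}" using assms(2) by auto
  ultimately show ?thesis using assms(1) by (simp add: rem_eq)
qed

lemma speed_integrable_Icc: "set_integrable lborel {t..u} (speed I S)"
  using S_integrable_Icc unfolding speed_def set_integrable_def scaleR_sum_right
  by (intro Bochner_Integration.integrable_sum) auto

lemma sum_rem_diff:
  assumes "t \<le> u"
  shows "(\<Sum>x\<in>tasks I. rem I S x t - rem I S x u) = (LINT v:{t..u}|lborel. speed I S v)"
proof -
  have "(\<Sum>x\<in>tasks I. rem I S x t - rem I S x u) = (\<Sum>x\<in>tasks I. LINT v:{t..u}|lborel. S x v)"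
    using rem_diff[OF _ assms] by (intro sum.cong) auto
  also have "\<dots> = (LINT v:{t..u}|lborel. speed I S v)"
    using S_integrable_Icc
    unfolding speed_def set_lebesgue_integral_def set_integrable_def scaleR_sum_right
    by (intro Bochner_Integration.integral_sum[symmetric]) auto
  finally show ?thesis .
qed

lemma rem_antimono: "x \<in> tasks I \<Longrightarrow> antimono (rem I S x)"
proof (rule antimonoI)
  fix t u :: real assume "x \<in> tasks I" "t \<le> u"
  then have "rem I S x t - rem I S x u = (LINT v:{t..u}|lborel. S x v)" by (rule rem_diff)
  also have "\<dots> \<ge> 0" using S_nonneg by (simp add: set_lebesgue_integral_def)
  finally show "rem I S x u \<le> rem I S x t" by simp
qed

lemma rem_before_release: "t < release I x \<Longrightarrow> rem I S x t = tsize I x"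
  by (intro rem_idle S_before_release) simp

lemma is_done_iff:
  assumes "x \<in> tasks I" shows "is_done I S x t \<longleftrightarrow> rem I S x t \<le> 0"
proof -
  have "work S x t = ennreal (enn2real (work S x t))"
    using work_finite[OF assms, of t] by simp
  then show ?thesis
    unfolding is_done_def rem_def using size_pos[OF assms]
    by (metis diff_le_0_iff_le enn2real_nonneg ennreal_le_iff)
qed

lemma unfinished_iff: "unfinished I S x t \<longleftrightarrow> x \<in> tasks I \<and> release I x \<le> t \<and> 0 < rem I S x t"
  using is_done_iff[of x t] by (auto simp: unfinished_def)

lemma umaps_eq: "umaps I S t = {x \<in> map_tasks I. release I x \<le> t \<and> 0 < rem I S x t}"
  by (auto simp: umaps_def unfinished_iff map_tasks_def)

lemma ureds_eq: "ureds I S t = {x \<in> reduce_tasks I. release I x \<le> t \<and> 0 < rem I S x t}"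
  by (auto simp: ureds_def unfinished_iff reduce_tasks_def)

lemma ajobs_eq: "ajobs I S t = {i \<in> {..<njobs I}. rel I i \<le> t \<and> 0 < job_rem I S i t}"
  by (auto simp: ajobs_iff unfinished_iff job_rem_pos_iff)

lemma cumrem_eq_job_rem:
  assumes "i \<in> ajobs I S t"
  shows "cumrem I S i t = job_rem I S i t"
proof -
  have "rel I i \<le> t" "i < njobs I" using assms by (auto simp: ajobs_eq)
  then have "y \<in> {y \<in> umaps I S t. job y = i}
      \<longleftrightarrow> y \<in> MapT i ` {k\<in>{..<nmap I i}. 0 < rem I S (MapT i k) t}" for y
    by (cases y) (auto simp: umaps_def unfinished_iff)
  then have "{y \<in> umaps I S t. job y = i} = MapT i ` {k\<in>{..<nmap I i}. 0 < rem I S (MapT i k) t}"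
    by blast
  then have "cumrem I S i t = (\<Sum>k\<in>{k\<in>{..<nmap I i}. 0 < rem I S (MapT i k) t}. rem I S (MapT i k) t)"
    by (simp add: cumrem_def sum.reindex inj_on_def)
  also have "\<dots> = job_rem I S i t"
    unfolding job_rem_def by (intro sum.mono_neutral_cong_left) auto
  finally show ?thesis .
qed

lemma job_rem_antimono: "i < njobs I \<Longrightarrow> antimono (job_rem I S i)"
  unfolding job_rem_def using antimonoD[OF rem_antimono]
  by (intro antimonoI sum_mono max.mono) auto

lemma job_rem_before_release:
  "t < rel I i \<Longrightarrow> job_rem I S i t = (\<Sum>k<nmap I i. max 0 (tsize I (MapT i k)))"
  by (simp add: job_rem_def rem_before_release)

lemma sum_job_rem_diff_le:
  assumes "t \<le> u"
  shows "(\<Sum>i<njobs I. job_rem I S i t - job_rem I S i u)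
    \<le> (\<Sum>x\<in>map_tasks I. rem I S x t - rem I S x u)"
  unfolding sum_map_tasks job_rem_def sum_subtractf[symmetric]
proof (intro sum_mono)
  fix i k assume "i \<in> {..<njobs I}" "k \<in> {..<nmap I i}"
  then show "max 0 (rem I S (MapT i k) t) - max 0 (rem I S (MapT i k) u)
      \<le> rem I S (MapT i k) t - rem I S (MapT i k) u"
    using antimonoD[OF rem_antimono assms, of "MapT i k"] by simp
qed

lemma sum_job_speed_le: "(\<Sum>i<njobs I. job_speed I S i t) \<le> (\<Sum>x\<in>map_tasks I. S x t)"
  unfolding sum_map_tasks job_speed_def using S_nonneg by (intro sum_mono) auto

lemma speed_le_job_speed:
  assumes "k < nmap I i" "0 < rem I S (MapT i k) t"
  shows "S (MapT i k) t \<le> job_speed I S i t"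
proof -
  have "S (MapT i k) t = (if 0 < rem I S (MapT i k) t then S (MapT i k) t else 0)"
    using assms by simp
  also have "\<dots> \<le> job_speed I S i t"
    unfolding job_speed_def using assms S_nonneg by (intro member_le_sum) auto
  finally show ?thesis .
qed

lemma card_ureds: "card (ureds I S t) = card (freereds I S t) + nred I * card (ajobs I S t)"
proof -
  let ?blocked = "(\<lambda>(i, k). RedT i k) ` (ajobs I S t \<times> {..<nred I})"
  have blocked_unfinished: "unfinished I S (RedT i k) t"
    if active: "i \<in> ajobs I S t" "k < nred I" for i k
  proof -
    obtain k' where k': "k' < nmap I i" "i < njobs I" "rel I i \<le> t" "0 < rem I S (MapT i k') t"
      using active(1) by (auto simp: ajobs_iff unfinished_iff)
    then have "S (RedT i k) u = 0" if "u \<le> t" for u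
      using S_reduce[of i k u k'] is_done_mono[of I S "MapT i k'" u t] that
      by (auto simp: is_done_iff)
    then have "rem I S (RedT i k) t = tsize I (RedT i k)" by (rule rem_idle)
    then show ?thesis using k' active(2) size_pos[of "RedT i k"] by (simp add: unfinished_iff)
  qed
  have free_iff: "RedT i k \<in> freereds I S t \<longleftrightarrow> unfinished I S (RedT i k) t \<and> i \<notin> ajobs I S t" for i k
    by (auto simp: freereds_def ajobs_iff unfinished_def)
  have "x \<in> ureds I S t \<longleftrightarrow> x \<in> freereds I S t \<union> ?blocked" for x
  proof (cases x)
    case (RedT i k)
    then show ?thesis using blocked_unfinished by (auto simp: ureds_def free_iff unfinished_def)
  qed (auto simp: ureds_def freereds_def)
  then have "ureds I S t = freereds I S t \<union> ?blocked" by blast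
  moreover have "freereds I S t \<inter> ?blocked = {}" by (auto simp: free_iff)
  moreover have "card ?blocked = nred I * card (ajobs I S t)"
    by (subst card_image) (auto simp: inj_on_def)
  ultimately show ?thesis by (simp add: card_Un_disjoint)
qed

lemma cost_rate_eq: "cost_rate I \<alpha> S t = real (card (umaps I S t)) + real (card (freereds I S t))
    + real (nred I * card (ajobs I S t)) + speed I S t powr \<alpha>"
  by (simp add: cost_rate_def card_unfinished_split card_ureds)

lemma speed_measurable [measurable]: "speed I S \<in> borel_measurable borel"
  unfolding speed_def by measurable

lemma cost_rate_measurable [measurable]: "cost_rate I \<alpha> S \<in> borel_measurable borel"
proof -
  have [measurable]: "rem I S x \<in> borel_measurable borel" if "x \<in> tasks I" for x
    using rem_antimono[OF that] by (rule borel_measurable_antimono)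
  have card_eq: "real (card {x. unfinished I S x t})
      = (\<Sum>x\<in>tasks I. indicator {release I x..} t * indicator {0<..} (rem I S x t))" for t
  proof -
    have "(\<Sum>x\<in>tasks I. indicator {release I x..} t * indicator {0<..} (rem I S x t))
        = (\<Sum>x\<in>tasks I. if unfinished I S x t then 1 else 0 :: real)"
      by (intro sum.cong) (auto simp: unfinished_iff split: split_indicator)
    also have "\<dots> = real (card {x\<in>tasks I. unfinished I S x t})"
      by (simp add: sum.If_cases Int_def)
    also have "{x\<in>tasks I. unfinished I S x t} = {x. unfinished I S x t}"
      by (auto simp: unfinished_def)
    finally show ?thesis by simp
  qed
  show ?thesis unfolding cost_rate_def card_eq by measurable
qed

definition regular_time :: "real \<Rightarrow> bool" where
  "regular_time t \<longleftrightarrow> (\<forall>x\<in>tasks I. (rem I S x has_real_derivative - S x t) (at_right t))"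

lemma AE_regular_time: "AE t in lborel. regular_time t"
  unfolding regular_time_def
proof (subst AE_finite_all[OF finite_tasks], intro ballI)
  fix x assume x: "x \<in> tasks I"
  have "AE t in lborel. ((\<lambda>u. - rem I S x u) has_real_derivative S x t) (at_right t)"
    using S_integrable_Icc[OF x] rem_diff[OF x] by (intro AE_has_right_derivative_integral) auto
  then show "AE t in lborel. (rem I S x has_real_derivative - S x t) (at_right t)"
    by eventually_elim (drule DERIV_minus, simp)
qed

lemma job_rem_has_derivative:
  assumes "regular_time t" "i < njobs I"
  shows "(job_rem I S i has_real_derivative - job_speed I S i t) (at_right t)"
proof -
  have "((\<lambda>u. max 0 (rem I S (MapT i k) u)) has_real_derivative
      (if 0 < rem I S (MapT i k) t then - S (MapT i k) t else 0)) (at_right t)"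
    if "k < nmap I i" for k
    using assms that
    by (intro has_real_derivative_max_0_at_right rem_antimono) (auto simp: regular_time_def)
  then have "((\<lambda>u. \<Sum>k<nmap I i. max 0 (rem I S (MapT i k) u)) has_real_derivative
      (\<Sum>k<nmap I i. if 0 < rem I S (MapT i k) t then - S (MapT i k) t else 0)) (at_right t)"
    by (intro DERIV_sum) simp
  moreover have "(\<Sum>k<nmap I i. if 0 < rem I S (MapT i k) t then - S (MapT i k) t else 0)
      = - job_speed I S i t"
    unfolding job_speed_def sum_negf[symmetric] by (intro sum.cong) auto
  ultimately show ?thesis by (simp add: job_rem_def[abs_def])
qed

end

lemma work_finite_if_dominated:
  assumes before: "\<And>u. u < r \<Longrightarrow> S x u = 0" and le: "\<And>u. S x u \<le> c + f u"
    and nonneg: "0 \<le> c" "\<And>u. 0 \<le> f u"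
    and [measurable]: "f \<in> borel_measurable borel"
    and f_finite: "(\<integral>\<^sup>+u. ennreal (f u) \<partial>lborel) < \<infinity>"
  shows "work S x t < \<infinity>"
proof -
  have "work S x t \<le> (\<integral>\<^sup>+u. ennreal c * indicator {r..t} u + ennreal (f u) \<partial>lborel)"
    unfolding work_def
  proof (rule nn_integral_mono)
    fix u
    have "ennreal (S x u) \<le> ennreal c + ennreal (f u)"
      using ennreal_leI[OF le[of u]] nonneg by (simp add: ennreal_plus)
    then show "ennreal (S x u) * indicator {..t} u \<le> ennreal c * indicator {r..t} u + ennreal (f u)"
      using before[of u] by (cases "u < r") (auto split: split_indicator)
  qed
  also have "\<dots> = ennreal c * emeasure lborel {r..t} + (\<integral>\<^sup>+u. ennreal (f u) \<partial>lborel)"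
    by (simp add: nn_integral_add nn_integral_cmult_indicator)
  also have "\<dots> < \<infinity>"
    using f_finite by (simp add: ennreal_mult_less_top emeasure_lborel_Icc_eq)
  finally show ?thesis .
qed

lemma mr_run_if_finite_cost:
  assumes "valid_instance I" "feasible I T" "1 < \<alpha>" and "cost I \<alpha> T < \<infinity>"
  shows "mr_run I T"
proof
  show "valid_instance I" "feasible I T" by fact+
  fix x t assume x: "x \<in> tasks I"
  have [measurable]: "T y \<in> borel_measurable borel" and T_nonneg: "0 \<le> T y u"
    and T_before: "u < release I y \<Longrightarrow> T y u = 0" for y u
    using assms(2) by (auto simp: feasible_def)
  show "work T x t < \<infinity>"
  proof (rule work_finite_if_dominated[where c = 1 and f = "\<lambda>u. speed I T u powr \<alpha>"])
    fix u
    have "T x u \<le> speed I T u"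
      unfolding speed_def using x T_nonneg by (intro member_le_sum) auto
    also have "\<dots> \<le> 1 + speed I T u powr \<alpha>"
    proof (cases "speed I T u \<le> 1")
      case True
      then show ?thesis using powr_ge_zero[of "speed I T u" \<alpha>] by linarith
    next
      case False
      then have "speed I T u powr 1 \<le> speed I T u powr \<alpha>" using assms(3) by (intro powr_mono) auto
      then show ?thesis using False by simp
    qed
    finally show "T x u \<le> 1 + speed I T u powr \<alpha>" .
  next
    have "(\<integral>\<^sup>+u. ennreal (speed I T u powr \<alpha>) \<partial>lborel) \<le> cost I \<alpha> T"
      unfolding cost_eq cost_rate_def by (intro nn_integral_mono ennreal_leI) simp
    then show "(\<integral>\<^sup>+u. ennreal (speed I T u powr \<alpha>) \<partial>lborel) < \<infinity>"
      using assms(4) by (rule le_less_trans)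
  qed (use T_before in \<open>auto simp: speed_def\<close>)
qed

section \<open>The coefficients of the combined potential\<close>

definition competitive_ratio :: "real \<Rightarrow> real" where
  "competitive_ratio \<alpha> = 8 + 4 / (2 - \<alpha>) + 3 powr \<alpha>"

definition map_coeff :: "real \<Rightarrow> real" where
  "map_coeff \<alpha> = 1 + 3 * 3 powr (\<alpha> - 1)"

definition reduce_coeff :: "real \<Rightarrow> real" where
  "reduce_coeff \<alpha> = 1 + 2 * 3 powr (\<alpha> - 1)"

lemma map_coeff_pos: "0 < map_coeff \<alpha>" and reduce_coeff_pos: "0 < reduce_coeff \<alpha>"
  by (simp_all add: map_coeff_def reduce_coeff_def add_pos_nonneg)

lemma competitive_ratio_pos: "\<alpha> < 2 \<Longrightarrow> 0 < competitive_ratio \<alpha>"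
  by (simp add: competitive_ratio_def add_pos_pos)

lemma three_powr_le:
  fixes \<alpha> :: real
  assumes "1 < \<alpha>" "\<alpha> < 2"
  shows "3 powr (\<alpha> - 1) \<le> 2 * \<alpha> - 1"
  using Youngs_inequality_0[of "\<alpha> - 1" "2 - \<alpha>" 3 1] assms by simp

lemma quadratic_le_four_divide:
  fixes a :: real
  assumes "0 \<le> a" "a < 1"
  shows "36 * a\<^sup>2 - 12 * a + 4 \<le> 4 / (1 - a)"
proof -
  have "(36 * a\<^sup>2 - 12 * a + 4) * (1 - a) = 4 - 4 * a * (3 * a - 2)\<^sup>2"
    by (simp add: power2_eq_square algebra_simps)
  also have "\<dots> \<le> 4" using assms by simp
  finally show ?thesis using assms by (simp add: pos_le_divide_eq)
qed

text \<open>Substituting \<open>a = \<alpha> - 1\<close> and \<open>3\<^bsup>a\<^esup> \<le> 1 + 2 a\<close> leaves polynomial inequalities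
  in \<open>a\<close>.\<close>

lemma coefficients_le_competitive_ratio:
  assumes "1 < \<alpha>" "\<alpha> < 2"
  shows "\<alpha> * map_coeff \<alpha> \<le> competitive_ratio \<alpha>"
    and "\<alpha> * (1 + \<alpha>) * reduce_coeff \<alpha> \<le> competitive_ratio \<alpha>"
    and "map_coeff \<alpha> + (1 + \<alpha>) * reduce_coeff \<alpha> \<le> competitive_ratio \<alpha>"
proof -
  define a where "a = \<alpha> - 1"
  define y where "y = 3 powr (\<alpha> - 1)"
  have \<alpha>: "\<alpha> = 1 + a" and a: "0 < a" "a < 1" using assms by (auto simp: a_def)
  have y: "y \<le> 1 + 2 * a" using three_powr_le[OF assms] by (simp add: y_def a_def)
  have "3 powr \<alpha> = 3 * y" by (simp add: y_def powr_diff)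
  then have ratio: "8 + (36 * a\<^sup>2 - 12 * a + 4) + 3 * y \<le> competitive_ratio \<alpha>"
    using quadratic_le_four_divide[of a] a by (simp add: competitive_ratio_def \<alpha>)
  have coeffs: "map_coeff \<alpha> = 1 + 3 * y" "reduce_coeff \<alpha> = 1 + 2 * y"
    by (auto simp: map_coeff_def reduce_coeff_def y_def)
  have ay: "a * y \<le> a * (1 + 2 * a)" using y a by (intro mult_left_mono) auto
  have aay: "a\<^sup>2 * y \<le> a\<^sup>2 * (1 + 2 * a)" using y by (intro mult_left_mono) auto
  have squares: "0 \<le> (a - 4 / 15)\<^sup>2" "0 \<le> (a - 23 / 34)\<^sup>2" "0 \<le> (a - 23 / 64)\<^sup>2" by simp_all
  have "a ^ 3 \<le> a\<^sup>2" using a by (intro power_decreasing) auto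
  then have cubic: "4 * a ^ 3 + 23 * a \<le> 21 * a\<^sup>2 + 9"
    using squares(2) by (simp add: power2_eq_square algebra_simps)
  note poly = power2_eq_square power3_eq_cube algebra_simps
  show "\<alpha> * map_coeff \<alpha> \<le> competitive_ratio \<alpha>"
    using ratio ay squares(1) a unfolding coeffs by (simp add: \<alpha> poly)
  show "\<alpha> * (1 + \<alpha>) * reduce_coeff \<alpha> \<le> competitive_ratio \<alpha>"
    using ratio y ay aay cubic a unfolding coeffs by (simp add: \<alpha> poly)
  show "map_coeff \<alpha> + (1 + \<alpha>) * reduce_coeff \<alpha> \<le> competitive_ratio \<alpha>"
    using ratio y ay squares(3) a unfolding coeffs by (simp add: \<alpha> poly)
qed

lemma combined_drift_le:
  assumes \<alpha>: "1 < \<alpha>" "\<alpha> < 2"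
    and nonneg: "0 \<le> m'" "0 \<le> f'" "0 \<le> J'" "0 \<le> s" and speeds: "p \<le> s" "q \<le> s"
  shows "map_coeff \<alpha> * (p + (\<alpha> - 1) * m - \<alpha> * m + \<alpha> * m')
      + \<alpha> * reduce_coeff \<alpha> * (p + (\<alpha> - 1) * J - \<alpha> * J + \<alpha> * J')
      + reduce_coeff \<alpha> * (q + (\<alpha> - 1) * (f + J) - \<alpha> * f + \<alpha> * (f' + J'))
    \<le> competitive_ratio \<alpha> * (m' + f' + J' + s) - (map_coeff \<alpha> * m + reduce_coeff \<alpha> * (f + J))"
proof -
  let ?c = "map_coeff \<alpha>" and ?d = "reduce_coeff \<alpha>" and ?R = "competitive_ratio \<alpha>"
  note R = coefficients_le_competitive_ratio[OF \<alpha>]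
  have pos: "0 \<le> ?c" "0 \<le> ?d" "0 \<le> \<alpha> * ?d"
    using map_coeff_pos[of \<alpha>] reduce_coeff_pos[of \<alpha>] \<alpha> by simp_all
  have "\<alpha> * ?d * 1 \<le> \<alpha> * ?d * (1 + \<alpha>)" using pos \<alpha> by (intro mult_left_mono) auto
  then have "\<alpha> * ?d \<le> ?R" using R(2) by (simp add: mult_ac)
  have "?c * (p + (\<alpha> - 1) * m - \<alpha> * m + \<alpha> * m')
      + \<alpha> * ?d * (p + (\<alpha> - 1) * J - \<alpha> * J + \<alpha> * J')
      + ?d * (q + (\<alpha> - 1) * (f + J) - \<alpha> * f + \<alpha> * (f' + J'))
    = (?c + \<alpha> * ?d) * p + ?d * q + \<alpha> * ?c * m' + \<alpha> * ?d * f' + \<alpha> * (1 + \<alpha>) * ?d * J'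
      - (?c * m + ?d * (f + J))"
    by (simp add: algebra_simps)
  also have "\<dots> \<le> (?c + \<alpha> * ?d) * s + ?d * s + ?R * m' + ?R * f' + ?R * J' - (?c * m + ?d * (f + J))"
    using pos nonneg speeds R \<open>\<alpha> * ?d \<le> ?R\<close>
    by (intro diff_right_mono add_mono mult_left_mono mult_right_mono) auto
  also have "(?c + \<alpha> * ?d) * s + ?d * s = (?c + (1 + \<alpha>) * ?d) * s" by (simp add: algebra_simps)
  also have "\<dots> \<le> ?R * s" using R(3) nonneg by (intro mult_right_mono)
  finally show ?thesis by (simp add: algebra_simps)
qed

section \<open>The algorithm\<close>

definition rate :: "real \<Rightarrow> nat \<Rightarrow> real" where
  "rate \<alpha> n = (real n + 1) powr (1 / \<alpha>)"

definition map_rate :: "mrinst \<Rightarrow> real \<Rightarrow> schedule \<Rightarrow> real \<Rightarrow> real" where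
  "map_rate I \<alpha> S t = (if umaps I S t \<noteq> {} then rate \<alpha> (card (umaps I S t)) else 0)"

definition job_rate :: "mrinst \<Rightarrow> real \<Rightarrow> schedule \<Rightarrow> real \<Rightarrow> real" where
  "job_rate I \<alpha> S t = (if umaps I S t \<noteq> {} then rate \<alpha> (nred I * card (ajobs I S t)) else 0)"

definition reduce_rate :: "mrinst \<Rightarrow> real \<Rightarrow> schedule \<Rightarrow> real \<Rightarrow> real" where
  "reduce_rate I \<alpha> S t = (if freereds I S t \<noteq> {} then rate \<alpha> (card (freereds I S t)) else 0)"

lemma rate_nonneg: "0 \<le> rate \<alpha> n"
  by (simp add: rate_def)

lemma rate_mono: "0 < \<alpha> \<Longrightarrow> m \<le> n \<Longrightarrow> rate \<alpha> m \<le> rate \<alpha> n"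
  unfolding rate_def by (intro powr_mono2) auto

lemma rate_powr: "0 < \<alpha> \<Longrightarrow> rate \<alpha> n powr \<alpha> = real n + 1"
  by (simp add: rate_def powr_powr)

lemma rates_nonneg: "0 \<le> map_rate I \<alpha> S t" "0 \<le> job_rate I \<alpha> S t" "0 \<le> reduce_rate I \<alpha> S t"
  by (simp_all add: map_rate_def job_rate_def reduce_rate_def rate_nonneg)

lemma
  assumes "alg_rule I \<alpha> S"
  shows alg_serves_map: "umaps I S t \<noteq> {} \<Longrightarrow> \<exists>x\<in>umaps I S t.
      (\<forall>y\<in>umaps I S t. rem I S x t \<le> rem I S y t) \<and> rate \<alpha> (card (umaps I S t)) \<le> S x t"
    and alg_serves_job: "umaps I S t \<noteq> {} \<Longrightarrow> \<exists>x\<in>umaps I S t.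
      (\<forall>j\<in>ajobs I S t. cumrem I S (job x) t \<le> cumrem I S j t) \<and>
      rate \<alpha> (nred I * card (ajobs I S t)) \<le> S x t"
    and alg_serves_free_reduce: "freereds I S t \<noteq> {} \<Longrightarrow> \<exists>x\<in>freereds I S t.
      (\<forall>y\<in>freereds I S t. rem I S x t \<le> rem I S y t) \<and> rate \<alpha> (card (freereds I S t)) \<le> S x t"
    and alg_nonneg: "0 \<le> S x t"
    and alg_support: "S x t \<noteq> 0 \<Longrightarrow> x \<in> umaps I S t \<union> freereds I S t"
    and alg_speed_le: "finite X \<Longrightarrow>
      (\<Sum>x\<in>X. S x t) \<le> map_rate I \<alpha> S t + job_rate I \<alpha> S t + reduce_rate I \<alpha> S t"
proof -
  let ?maps = "umaps I S t" and ?frees = "freereds I S t"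
  obtain x1 x2 x3 where
    x1: "?maps \<noteq> {} \<Longrightarrow> x1 \<in> ?maps \<and> (\<forall>y\<in>?maps. rem I S x1 t \<le> rem I S y t)" and
    x2: "?maps \<noteq> {} \<Longrightarrow> x2 \<in> ?maps \<and> (\<forall>j\<in>ajobs I S t. cumrem I S (job x2) t \<le> cumrem I S j t)" and
    x3: "?frees \<noteq> {} \<Longrightarrow> x3 \<in> ?frees \<and> (\<forall>y\<in>?frees. rem I S x3 t \<le> rem I S y t)" and
    S_eq: "\<And>x. S x t = (if ?maps \<noteq> {} \<and> x = x1 then rate \<alpha> (card ?maps) else 0)
        + (if ?maps \<noteq> {} \<and> x = x2 then rate \<alpha> (nred I * card (ajobs I S t)) else 0)
        + (if ?frees \<noteq> {} \<and> x = x3 then rate \<alpha> (card ?frees) else 0)"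
    using assms unfolding alg_rule_def rate_def by metis
  have S: "S x t = (if x = x1 then map_rate I \<alpha> S t else 0)
      + (if x = x2 then job_rate I \<alpha> S t else 0)
      + (if x = x3 then reduce_rate I \<alpha> S t else 0)" for x
    by (simp add: S_eq map_rate_def job_rate_def reduce_rate_def)
  show "0 \<le> S x t" by (simp add: S rates_nonneg)
  have served: "map_rate I \<alpha> S t \<le> S x1 t" "job_rate I \<alpha> S t \<le> S x2 t"
    "reduce_rate I \<alpha> S t \<le> S x3 t"
    by (simp_all add: S rates_nonneg)
  show "\<exists>x\<in>?maps. (\<forall>y\<in>?maps. rem I S x t \<le> rem I S y t) \<and> rate \<alpha> (card ?maps) \<le> S x t"
    if "?maps \<noteq> {}"
    using x1[OF that] served(1) that by (auto simp: map_rate_def)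
  show "\<exists>x\<in>?maps. (\<forall>j\<in>ajobs I S t. cumrem I S (job x) t \<le> cumrem I S j t) \<and>
      rate \<alpha> (nred I * card (ajobs I S t)) \<le> S x t" if "?maps \<noteq> {}"
    using x2[OF that] served(2) that by (auto simp: job_rate_def)
  show "\<exists>x\<in>?frees. (\<forall>y\<in>?frees. rem I S x t \<le> rem I S y t) \<and> rate \<alpha> (card ?frees) \<le> S x t"
    if "?frees \<noteq> {}"
    using x3[OF that] served(3) that by (auto simp: reduce_rate_def)
  show "x \<in> ?maps \<union> ?frees" if "S x t \<noteq> 0"
    using that x1 x2 x3 unfolding S_eq by (auto split: if_splits)
  show "(\<Sum>x\<in>X. S x t) \<le> map_rate I \<alpha> S t + job_rate I \<alpha> S t + reduce_rate I \<alpha> S t" if "finite X"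
    unfolding S sum.distrib using that by (intro add_mono) (simp_all add: sum.delta' rates_nonneg)
qed

lemma alg_feasible:
  assumes "\<forall>x. S x \<in> borel_measurable lborel" "alg_rule I \<alpha> S"
  shows "feasible I S"
proof -
  have "S x t = 0" if "t < release I x" for x t
    using alg_support[OF assms(2), of x t] that
    by (auto simp: umaps_def freereds_def unfinished_def)
  moreover have "is_done I S (MapT i k') t" if "S (RedT i k) t \<noteq> 0" "k' < nmap I i" for i k k' t
    using alg_support[OF assms(2), of "RedT i k" t] that
    by (auto simp: umaps_def freereds_def)
  ultimately show ?thesis
    using assms(1) alg_nonneg[OF assms(2)] unfolding feasible_def by blast
qed

lemma alg_bounded:
  assumes "alg_rule I \<alpha> S" "0 < \<alpha>"
  shows "S x t \<le> 3 * rate \<alpha> ((nred I + 1) * card (tasks I))"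
proof -
  let ?N = "(nred I + 1) * card (tasks I)"
  have maps: "card (umaps I S t) \<le> card (tasks I)"
    and frees: "card (freereds I S t) \<le> card (tasks I)"
    by (auto intro!: card_mono simp: umaps_def freereds_def unfinished_def)
  have "card (ajobs I S t) \<le> card (umaps I S t)"
    unfolding ajobs_def by (rule card_image_le) simp
  then have "nred I * card (ajobs I S t) \<le> ?N"
    using maps by (intro mult_le_mono) auto
  moreover have "card (umaps I S t) \<le> ?N" "card (freereds I S t) \<le> ?N"
    using maps frees by (simp_all add: trans_le_add1)
  ultimately have "map_rate I \<alpha> S t \<le> rate \<alpha> ?N" "job_rate I \<alpha> S t \<le> rate \<alpha> ?N"
    "reduce_rate I \<alpha> S t \<le> rate \<alpha> ?N"
    using rate_mono[OF assms(2)] by (auto simp: map_rate_def job_rate_def reduce_rate_def rate_nonneg)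
  then show ?thesis
    using alg_speed_le[OF assms(1), of "{x}" t] by simp
qed

lemma mr_run_if_alg:
  assumes "\<forall>x. S x \<in> borel_measurable lborel" "alg_rule I \<alpha> S" "valid_instance I" "0 < \<alpha>"
  shows "mr_run I S"
proof
  show "valid_instance I" by fact
  show feas: "feasible I S" using assms alg_feasible by blast
  show "work S x t < \<infinity>" if "x \<in> tasks I" for x t
    by (rule work_finite_if_dominated[where r = "release I x" and f = "\<lambda>_. 0"
          and c = "3 * rate \<alpha> ((nred I + 1) * card (tasks I))"])
       (use feas alg_bounded[OF assms(2,4)] in \<open>auto simp: feasible_def rate_nonneg\<close>)
qed

lemma alg_cost_rate_le:
  assumes "mr_run I S" "alg_rule I \<alpha> S" "1 < \<alpha>"
  shows "cost_rate I \<alpha> S t \<le> map_coeff \<alpha> * real (card (umaps I S t))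
    + reduce_coeff \<alpha> * (real (card (freereds I S t)) + real (nred I * card (ajobs I S t)))"
proof -
  interpret mr_run I S by fact
  let ?m = "card (umaps I S t)" and ?J = "nred I * card (ajobs I S t)" and ?f = "card (freereds I S t)"
  let ?p = "map_rate I \<alpha> S t" and ?q = "job_rate I \<alpha> S t" and ?r = "reduce_rate I \<alpha> S t"
  have "speed I S t powr \<alpha> \<le> (?p + ?q + ?r) powr \<alpha>"
    unfolding speed_def using assms(3) S_nonneg
    by (intro powr_mono2 alg_speed_le[OF assms(2)] sum_nonneg) auto
  also have "\<dots> \<le> 3 powr (\<alpha> - 1) * (?p powr \<alpha> + ?q powr \<alpha> + ?r powr \<alpha>)"
  proof -
    have "0 \<le> [?p, ?q, ?r] ! i" if "i \<in> {..<3}" for i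
      using that rates_nonneg by (auto simp: numeral_3_eq_3 less_Suc_eq)
    from sum_powr_le[of \<alpha> "{..<3}" "\<lambda>i. [?p, ?q, ?r] ! i", OF assms(3) finite_lessThan this]
    show ?thesis by (simp add: numeral_3_eq_3 lessThan_Suc add_ac)
  qed
  also have "\<dots> \<le> 3 powr (\<alpha> - 1) * (3 * real ?m + 2 * real ?J + 2 * real ?f)"
  proof (intro mult_left_mono)
    have "umaps I S t \<noteq> {} \<longleftrightarrow> 1 \<le> ?m" "freereds I S t \<noteq> {} \<longleftrightarrow> 1 \<le> ?f"
      by (auto simp: Suc_le_eq card_gt_0_iff)
    then show "?p powr \<alpha> + ?q powr \<alpha> + ?r powr \<alpha> \<le> 3 * real ?m + 2 * real ?J + 2 * real ?f"
      using assms(3)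
      by (auto simp: map_rate_def job_rate_def reduce_rate_def rate_powr simp del: of_nat_mult)
  qed simp
  finally show ?thesis
    by (simp add: cost_rate_eq map_coeff_def reduce_coeff_def algebra_simps)
qed

section \<open>The algorithm against a competitor\<close>

locale mr_comparison = A: mr_run I S + O: mr_run I T for I S T +
  fixes \<alpha> :: real
  assumes \<alpha>: "1 < \<alpha>" "\<alpha> < 2" and alg: "alg_rule I \<alpha> S"
begin

sublocale Map: residual_race "map_tasks I" "release I" "rem I S" "rem I T" \<alpha> 1
  using \<alpha> map_tasks_subset A.rem_antimono O.rem_antimono
  by unfold_locales (auto simp: A.rem_before_release O.rem_before_release)

sublocale Job: residual_race "{..<njobs I}" "rel I" "job_rem I S" "job_rem I T" \<alpha> "real (nred I)"
  using \<alpha> A.job_rem_antimono O.job_rem_antimono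
  by unfold_locales (auto simp: A.job_rem_before_release O.job_rem_before_release)

sublocale Reduce: residual_race "reduce_tasks I" "release I" "rem I S" "rem I T" \<alpha> 1
  using \<alpha> reduce_tasks_subset A.rem_antimono O.rem_antimono
  by unfold_locales (auto simp: A.rem_before_release O.rem_before_release)

lemma Map_potential_dini:
  assumes "A.regular_time t" "O.regular_time t"
  defines "m U \<equiv> real (card (umaps I U t))"
  shows "dini_le Map.potential t
    ((\<Sum>x\<in>map_tasks I. T x t) powr \<alpha> + (\<alpha> - 1) * m S - \<alpha> * m S + \<alpha> * m T)"
proof -
  have "\<exists>x\<in>umaps I S t. (\<forall>y\<in>umaps I S t. rem I S x t \<le> rem I S y t) \<and>
      (\<exists>\<mu> \<ge> (1 * m S + 1) powr (1 / \<alpha>). (rem I S x has_real_derivative - \<mu>) (at_right t))"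
    if ne: "umaps I S t \<noteq> {}"
  proof -
    obtain x where x: "x \<in> umaps I S t" "\<forall>y\<in>umaps I S t. rem I S x t \<le> rem I S y t"
      "rate \<alpha> (card (umaps I S t)) \<le> S x t"
      using alg_serves_map[OF alg ne] by blast
    then have "(rem I S x has_real_derivative - S x t) (at_right t)"
      using assms(1) map_tasks_subset by (auto simp: A.regular_time_def A.umaps_eq)
    then show ?thesis using x by (auto simp: m_def rate_def)
  qed
  then show ?thesis
    using Map.potential_dini[where U = "umaps I S t" and n = "card (umaps I S t)"
        and v = "\<lambda>x. T x t" and t = t and s = "\<Sum>x\<in>map_tasks I. T x t"] assms(2) map_tasks_subset O.S_nonneg
    by (simp add: m_def A.umaps_eq O.umaps_eq O.regular_time_def subset_iff sum_nonneg)
qed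

lemma Job_potential_dini:
  assumes "A.regular_time t" "O.regular_time t"
  defines "J U \<equiv> real (nred I * card (ajobs I U t))"
  shows "dini_le Job.potential t
    ((\<Sum>x\<in>map_tasks I. T x t) powr \<alpha> + (\<alpha> - 1) * J S - \<alpha> * J S + \<alpha> * J T)"
proof -
  have "\<exists>i\<in>ajobs I S t. (\<forall>j\<in>ajobs I S t. job_rem I S i t \<le> job_rem I S j t) \<and>
      (\<exists>\<mu> \<ge> (real (nred I) * real (card (ajobs I S t)) + 1) powr (1 / \<alpha>).
        (job_rem I S i has_real_derivative - \<mu>) (at_right t))"
    if "ajobs I S t \<noteq> {}"
  proof -
    have "umaps I S t \<noteq> {}" using that by (simp add: ajobs_def)
    then obtain x where x: "x \<in> umaps I S t" "\<forall>j\<in>ajobs I S t. cumrem I S (job x) t \<le> cumrem I S j t"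
      "rate \<alpha> (nred I * card (ajobs I S t)) \<le> S x t"
      using alg_serves_job[OF alg] by blast
    then obtain i k where ik: "x = MapT i k" by (cases x) (auto simp: umaps_def)
    have i: "i \<in> ajobs I S t" "i < njobs I" and k: "k < nmap I i" "0 < rem I S (MapT i k) t"
      using x(1) ik by (auto simp: umaps_def ajobs_iff A.unfinished_iff)
    have "rate \<alpha> (nred I * card (ajobs I S t)) \<le> job_speed I S i t"
      using x(3) A.speed_le_job_speed[OF k] ik by simp
    moreover have "\<forall>j\<in>ajobs I S t. job_rem I S i t \<le> job_rem I S j t"
      using x(2) i ik by (simp add: A.cumrem_eq_job_rem)
    ultimately show ?thesis
      using i A.job_rem_has_derivative[OF assms(1) i(2)] by (auto simp: rate_def)
  qed
  then show ?thesis
    using Job.potential_dini[where U = "ajobs I S t" and n = "card (ajobs I S t)" and t = t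
        and v = "\<lambda>i. job_speed I T i t" and s = "\<Sum>x\<in>map_tasks I. T x t"]
      O.job_rem_has_derivative[OF assms(2)] O.sum_job_speed_le O.S_nonneg
    by (simp add: J_def A.ajobs_eq O.ajobs_eq sum_nonneg)
qed

lemma Reduce_potential_dini:
  assumes "A.regular_time t" "O.regular_time t"
  defines "J U \<equiv> real (nred I * card (ajobs I U t))" and "f U \<equiv> real (card (freereds I U t))"
  shows "dini_le Reduce.potential t ((\<Sum>x\<in>reduce_tasks I. T x t) powr \<alpha>
    + (\<alpha> - 1) * (f S + J S) - \<alpha> * f S + \<alpha> * (f T + J T))"
proof -
  have free: "freereds I S t \<subseteq> {x \<in> reduce_tasks I. release I x \<le> t \<and> 0 < rem I S x t}"
    using A.ureds_eq[of t] by (auto simp: freereds_def ureds_def)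
  have "\<exists>x\<in>freereds I S t. (\<forall>y\<in>freereds I S t. rem I S x t \<le> rem I S y t) \<and>
      (\<exists>\<mu> \<ge> (1 * f S + 1) powr (1 / \<alpha>). (rem I S x has_real_derivative - \<mu>) (at_right t))"
    if ne: "freereds I S t \<noteq> {}"
  proof -
    obtain x where x: "x \<in> freereds I S t" "\<forall>y\<in>freereds I S t. rem I S x t \<le> rem I S y t"
      "rate \<alpha> (card (freereds I S t)) \<le> S x t"
      using alg_serves_free_reduce[OF alg ne] by blast
    then have "(rem I S x has_real_derivative - S x t) (at_right t)"
      using assms(1) subsetD[OF free x(1)] by (simp add: A.regular_time_def reduce_tasks_def)
    then show ?thesis using x by (auto simp: f_def rate_def)
  qed
  moreover have "real (card (ureds I S t)) = f S + J S" "real (card (ureds I T t)) = f T + J T"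
    by (simp_all add: A.card_ureds O.card_ureds f_def J_def)
  ultimately show ?thesis
    using Reduce.potential_dini[where U = "freereds I S t" and n = "card (ureds I S t)"
        and v = "\<lambda>x. T x t" and t = t and s = "\<Sum>x\<in>reduce_tasks I. T x t"] assms(2) free reduce_tasks_subset O.S_nonneg
    by (simp add: f_def O.regular_time_def subset_iff sum_nonneg flip: A.ureds_eq O.ureds_eq)
qed

definition total_potential :: "real \<Rightarrow> real" where
  "total_potential t = map_coeff \<alpha> * Map.potential t + \<alpha> * reduce_coeff \<alpha> * Job.potential t
    + reduce_coeff \<alpha> * Reduce.potential t"

definition growth_bound :: real where
  "growth_bound = map_coeff \<alpha> * weight \<alpha> 1 (card (map_tasks I))
    + \<alpha> * reduce_coeff \<alpha> * weight \<alpha> (real (nred I)) (njobs I)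
    + reduce_coeff \<alpha> * weight \<alpha> 1 (card (reduce_tasks I))"

lemma coeffs_nonneg: "0 \<le> map_coeff \<alpha>" "0 \<le> reduce_coeff \<alpha>" "0 \<le> \<alpha> * reduce_coeff \<alpha>"
  using map_coeff_pos[of \<alpha>] reduce_coeff_pos[of \<alpha>] \<alpha> by simp_all

lemma total_potential_nonneg: "0 \<le> total_potential t"
  unfolding total_potential_def
  by (intro add_nonneg_nonneg mult_nonneg_nonneg coeffs_nonneg
      Map.potential_nonneg Job.potential_nonneg Reduce.potential_nonneg)

lemma total_potential_before_release:
  assumes "\<And>i. i < njobs I \<Longrightarrow> t < rel I i"
  shows "total_potential t = 0"
proof -
  have "t < release I x" if "x \<in> tasks I" for x
    using that assms by (cases x) auto
  then have "Map.potential t = 0" "Reduce.potential t = 0"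
    using map_tasks_subset reduce_tasks_subset
    by (intro Map.potential_before_release Reduce.potential_before_release; blast)+
  moreover have "Job.potential t = 0"
    using assms by (intro Job.potential_before_release) simp
  ultimately show ?thesis by (simp add: total_potential_def)
qed

lemma total_potential_dini:
  assumes "A.regular_time t" "O.regular_time t"
  shows "dini_le total_potential t (competitive_ratio \<alpha> * cost_rate I \<alpha> T t - cost_rate I \<alpha> S t)"
proof -
  define m J f where "m U = real (card (umaps I U t))" and "J U = real (nred I * card (ajobs I U t))"
    and "f U = real (card (freereds I U t))" for U
  define p q s where "p = (\<Sum>x\<in>map_tasks I. T x t) powr \<alpha>"
    and "q = (\<Sum>x\<in>reduce_tasks I. T x t) powr \<alpha>"
    and "s = speed I T t powr \<alpha>"
  let ?drift = "map_coeff \<alpha> * (p + (\<alpha> - 1) * m S - \<alpha> * m S + \<alpha> * m T)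
    + \<alpha> * reduce_coeff \<alpha> * (p + (\<alpha> - 1) * J S - \<alpha> * J S + \<alpha> * J T)
    + reduce_coeff \<alpha> * (q + (\<alpha> - 1) * (f S + J S) - \<alpha> * f S + \<alpha> * (f T + J T))"
  have "0 \<le> (\<Sum>x\<in>map_tasks I. T x t)" "0 \<le> (\<Sum>x\<in>reduce_tasks I. T x t)"
    using O.S_nonneg by (auto intro: sum_nonneg)
  then have "p \<le> s" "q \<le> s"
    using \<alpha> by (auto simp: p_def q_def s_def speed_def sum_tasks_split intro!: powr_mono2)
  then have "?drift \<le> competitive_ratio \<alpha> * (m T + f T + J T + s)
      - (map_coeff \<alpha> * m S + reduce_coeff \<alpha> * (f S + J S))"
    using \<alpha> by (intro combined_drift_le) (simp_all add: m_def J_def f_def s_def)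
  also have "\<dots> \<le> competitive_ratio \<alpha> * cost_rate I \<alpha> T t - cost_rate I \<alpha> S t"
    using alg_cost_rate_le[OF A.mr_run_axioms alg \<alpha>(1), of t]
    by (simp add: O.cost_rate_eq m_def J_def f_def s_def)
  finally have drift_le: "?drift \<le> competitive_ratio \<alpha> * cost_rate I \<alpha> T t - cost_rate I \<alpha> S t" .
  have "dini_le (\<lambda>u. map_coeff \<alpha> * Map.potential u + \<alpha> * reduce_coeff \<alpha> * Job.potential u
      + reduce_coeff \<alpha> * Reduce.potential u) t ?drift"
    unfolding m_def J_def f_def p_def q_def
    by (intro dini_le_add dini_le_cmult Map_potential_dini Job_potential_dini Reduce_potential_dini
        coeffs_nonneg assms)
  then show ?thesis
    unfolding total_potential_def using drift_le by (rule dini_le_mono)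
qed

lemma total_potential_increase_le:
  assumes "t \<le> u"
  shows "total_potential u - total_potential t
    \<le> growth_bound * (\<Sum>x\<in>tasks I. rem I T x t - rem I T x u)"
proof -
  let ?W = "\<Sum>x\<in>tasks I. rem I T x t - rem I T x u"
  have "0 \<le> (\<Sum>x\<in>X. rem I T x t - rem I T x u)" if "X \<subseteq> tasks I" for X
    using that antimonoD[OF O.rem_antimono assms] by (auto intro!: sum_nonneg)
  from this[OF map_tasks_subset] this[OF reduce_tasks_subset]
  have maps: "(\<Sum>x\<in>map_tasks I. rem I T x t - rem I T x u) \<le> ?W"
    and reduces: "(\<Sum>x\<in>reduce_tasks I. rem I T x t - rem I T x u) \<le> ?W"
    by (simp_all add: sum_tasks_split)
  note jobs = order_trans[OF O.sum_job_rem_diff_le[OF assms] maps]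
  have "total_potential u - total_potential t = map_coeff \<alpha> * (Map.potential u - Map.potential t)
      + \<alpha> * reduce_coeff \<alpha> * (Job.potential u - Job.potential t)
      + reduce_coeff \<alpha> * (Reduce.potential u - Reduce.potential t)"
    by (simp add: total_potential_def algebra_simps)
  also have "\<dots> \<le> map_coeff \<alpha> * (weight \<alpha> 1 (card (map_tasks I)) * ?W)
      + \<alpha> * reduce_coeff \<alpha> * (weight \<alpha> (real (nred I)) (card {..<njobs I}) * ?W)
      + reduce_coeff \<alpha> * (weight \<alpha> 1 (card (reduce_tasks I)) * ?W)"
    using Map.potential_increase_le[OF assms] Job.potential_increase_le[OF assms]
      Reduce.potential_increase_le[OF assms] maps jobs reduces weight_nonneg[OF \<alpha>(1)]
    by (intro add_mono mult_left_mono coeffs_nonneg) (blast intro: order_trans mult_left_mono)+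
  also have "\<dots> = growth_bound * ?W"
    by (simp add: growth_bound_def algebra_simps)
  finally show ?thesis .
qed

lemma alg_cost_rate_integrable: "set_integrable lborel {x..y} (cost_rate I \<alpha> S)"
proof -
  let ?K = "(map_coeff \<alpha> + reduce_coeff \<alpha>) * real (card (tasks I))"
  have "cost_rate I \<alpha> S t \<le> ?K" for t
  proof -
    have "card (umaps I S t) \<le> card (tasks I)" "card (ureds I S t) \<le> card (tasks I)"
      by (auto intro!: card_mono simp: umaps_def ureds_def unfinished_def)
    then have "map_coeff \<alpha> * real (card (umaps I S t))
        + reduce_coeff \<alpha> * real (card (ureds I S t)) \<le> ?K"
      unfolding distrib_right by (intro add_mono mult_left_mono coeffs_nonneg) simp_all
    then show ?thesis
      using alg_cost_rate_le[OF A.mr_run_axioms alg \<alpha>(1), of t] by (simp add: A.card_ureds)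
  qed
  then show ?thesis
    unfolding set_integrable_def
    by (intro integrableI_bounded_set_indicator[where B = ?K])
       (auto simp: cost_rate_nonneg emeasure_lborel_Icc_eq)
qed

lemma cost_le:
  assumes "cost I \<alpha> T < \<infinity>"
  shows "cost I \<alpha> S \<le> ennreal (competitive_ratio \<alpha>) * cost I \<alpha> T"
proof -
  note ratio_nonneg = less_imp_le[OF competitive_ratio_pos[OF \<alpha>(2)]]
  have T_int: "integrable lborel (cost_rate I \<alpha> T)"
    using assms cost_rate_nonneg unfolding cost_eq by (intro integrableI_nonneg) auto
  obtain t0 where t0: "\<And>i. i < njobs I \<Longrightarrow> t0 < rel I i"
  proof
    fix i assume "i < njobs I"
    then have "Min (insert 0 (rel I ` {..<njobs I})) \<le> rel I i" by (intro Min_le) auto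
    then show "Min (insert 0 (rel I ` {..<njobs I})) - 1 < rel I i" by simp
  qed
  let ?A = "\<lambda>t. - growth_bound * (\<Sum>x\<in>tasks I. rem I T x t)"
  have A_diff: "?A u - ?A t = growth_bound * (\<Sum>x\<in>tasks I. rem I T x t - rem I T x u)" for t u
    by (simp add: sum_subtractf right_diff_distrib)
  have "cost I \<alpha> S \<le> (\<integral>\<^sup>+t. ennreal (competitive_ratio \<alpha> * cost_rate I \<alpha> T t) \<partial>lborel)"
    unfolding cost_eq
  proof (rule amortized_nn_integral_le)
    show "set_integrable lborel {x..y} (\<lambda>t. competitive_ratio \<alpha> * cost_rate I \<alpha> T t)" for x y
      using T_int unfolding set_integrable_def by (intro integrable_mult_indicator) auto
    show "set_integrable lborel {x..y} (\<lambda>t. growth_bound * speed I T t)" for x y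
      by (intro set_integrable_mult_right O.speed_integrable_Icc)
    show "?A u - ?A t = (LINT v:{t..u}|lborel. growth_bound * speed I T v)" if "t \<le> u" for t u
      unfolding A_diff O.sum_rem_diff[OF that] by simp
    show "total_potential u - total_potential t \<le> ?A u - ?A t" if "t \<le> u" for t u
      unfolding A_diff using that by (rule total_potential_increase_le)
    show "AE t in lborel. dini_le total_potential t
        (competitive_ratio \<alpha> * cost_rate I \<alpha> T t - cost_rate I \<alpha> S t)"
      using A.AE_regular_time O.AE_regular_time by eventually_elim (rule total_potential_dini)
    show "total_potential t = 0" if "t \<le> t0" for t
      using that t0 by (intro total_potential_before_release) fastforce
  qed (use ratio_nonneg in
      \<open>simp_all add: alg_cost_rate_integrable cost_rate_nonneg total_potential_nonneg\<close>)
  also have "\<dots> = ennreal (competitive_ratio \<alpha>) * cost I \<alpha> T"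
    using ratio_nonneg by (simp add: cost_eq ennreal_mult' nn_integral_cmult)
  finally show ?thesis .
qed

end

theorem theorem3:
  fixes I :: mrinst and \<alpha> :: real and S :: schedule
  assumes "1 < \<alpha>" and "\<alpha> < 2"
    and "valid_instance I"
    and "\<forall>x. S x \<in> borel_measurable lborel"
    and "alg_rule I \<alpha> S"
  shows "cost I \<alpha> S \<le> ennreal (8 + 4 / (2 - \<alpha>) + 3 powr \<alpha>) * OPT I \<alpha>"
  unfolding OPT_def competitive_ratio_def[symmetric]
proof (rule ennreal_le_mult_INF)
  show ratio_pos: "0 < competitive_ratio \<alpha>" using assms(2) by (rule competitive_ratio_pos)
  fix T assume "T \<in> {T. feasible I T}"
  then have T: "feasible I T" by simp
  show "cost I \<alpha> S \<le> ennreal (competitive_ratio \<alpha>) * cost I \<alpha> T"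
  proof (cases "cost I \<alpha> T < \<infinity>")
    case True
    interpret mr_comparison I S T \<alpha>
    proof (intro mr_comparison.intro mr_comparison_axioms.intro)
      show "mr_run I S" using assms by (intro mr_run_if_alg) auto
      show "mr_run I T" using assms(3) T assms(1) True by (rule mr_run_if_finite_cost)
    qed (use assms in auto)
    show ?thesis using True by (rule cost_le)
  next
    case False
    then show ?thesis using ratio_pos by (simp add: ennreal_mult_top less_top[symmetric])
  qed
qed

end
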